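(* Let $\emptyset\neq\mathcal{A}\subseteq\mathbb{R}^n$ and $\mathcal{B}\subseteq\mathbb{N}^n\setminus(2\mathbb{N})^n$ be finite sets. The set $\mathcal{E}(\mathcal{A},\mathcal{B})$ of extreme rays of $C_{\mathcal{S}}(\mathcal{A},\mathcal{B})$ is $$\mathcal{E}(\mathcal{A},\mathcal{B})=\Big(\bigcup_{\substack{(A,\beta)\in I(\mathcal{A},\mathcal{A}),\\ r_{\mathrm e}(A,\beta)=0,\ |A|>1}}E_{\mathrm e}(A,\beta)\Big)\cup\Big(\bigcup_{\substack{(A,\beta)\in I(\mathcal{A},\mathcal{B}),\\ r_{\mathrm o}(A,\beta)=0,\ |A|>1}}E_{\mathrm o}(A,\beta)\Big)\cup\Big(\bigcup_{\beta\in\mathcal{A}}E_1(\beta)\Big);$$ that is, a nonzero $f\in C_{\mathcal{S}}(\mathcal{A},\mathcal{B})$ generates an extreme ray of $C_{\mathcal{S}}(\mathcal{A},\mathcal{B})$ if and only if $f$ belongs to the right-hand side.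
   Context: $\mathbb{N}=\{0,1,2,\ldots\}$, $\mathbb{R}_+=[0,\infty)$. For $x\in\mathbb{R}^n$, $\alpha\in\mathbb{R}^n$, $\beta\in\mathbb{N}^n$ put $|x|^\alpha=\prod_j|x_j|^{\alpha_j}$ and $x^\beta=\prod_j x_j^{\beta_j}$; if a component of $x$ is zero and the corresponding exponent is negative, then $|x|^\alpha=\infty$. For finite sets $\emptyset\neq\mathcal{A}\subseteq\mathbb{R}^n$ and $\mathcal{B}\subseteq\mathbb{N}^n\setminus(2\mathbb{N})^n$ (not necessarily disjoint), $\mathbb{R}[\mathcal{A},\mathcal{B}]$ is the real vector space, of dimension $|\mathcal{A}|+|\mathcal{B}|$, of all functions $f=\sum_{\alpha\in\mathcal{A}}c_\alpha|x|^\alpha+\sum_{\beta\in\mathcal{B}}d_\beta x^\beta$ with real coefficients. Such an $f$ is viewed as a function $\mathbb{R}^n\to\mathbb{R}\cup\{\infty\}$, with value $\infty$ at points where some monomial occurring in $f$ with nonzero coefficient is $\infty$; $f$ is non-negative if $f(x)\ge0$ for all $x\in\mathbb{R}^n$. Such an $f$ is an even AG function if at most one $c_\alpha$ is negative and all $d_\beta$ are zero; it is an odd AG function if all $c_\alpha$ are non-negative and at most one $d_\beta$ is nonzero; it is an AG function if it is an even or an odd AG function. The $\mathcal{S}$-cone $C_{\mathcal{S}}(\mathcal{A},\mathcal{B})$ is the conic hull (set of all finite non-negative linear combinations, including $0$) of the non-negative AG functions in $\mathbb{R}[\mathcal{A},\mathcal{B}]$. A nonzero element $f$ of a convex cone $C$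 generates an extreme ray if $f=\sum_i f_i$ with $f_i\in C$ implies that every $f_i$ is a non-negative multiple of $f$. A circuit is a pair $(A,\beta)$ with $A\subseteq\mathbb{R}^n$ affinely independent and $\beta\in\operatorname{relint}\operatorname{conv}(A)$; $\lambda=\lambda(A,\beta)\in\mathbb{R}_+^A$ denotes the unique vector with $\sum_{\alpha\in A}\lambda_\alpha\alpha=\beta$, $\sum_{\alpha\in A}\lambda_\alpha=1$. $I(\mathcal{A},\mathcal{A})$ is the set of circuits with $A\subseteq\mathcal{A}$, $\beta\in\mathcal{A}$, and $I(\mathcal{A},\mathcal{B})$ the set of circuits with $A\subseteq\mathcal{A}$, $\beta\in\mathcal{B}$. Put $r_{\mathrm e}(A,\beta)=|(\operatorname{conv}(A)\setminus(A\cup\{\beta\}))\cap\mathcal{A}|$ and $r_{\mathrm o}(A,\beta)=|(\operatorname{conv}(A)\setminus A)\cap\mathcal{A}|$. For $(A,\beta)\in I(\mathcal{A},\mathcal{A})$: $E_{\mathrm e}(A,\beta)=\{\sum_{\alpha\in A}c_\alpha|x|^\alpha-\prod_{\alpha\in A}(c_\alpha/\lambda_\alpha)^{\lambda_\alpha}|x|^\beta : c\in\mathbb{R}_{>0}^A\}$. For $(A,\beta)\in I(\mathcal{A},\mathcal{B})$: $E_{\mathrm o}(A,\beta)=\{\sum_{\alpha\in A}c_\alpha|x|^\alpha\pm\prod_{\alpha\in A}(c_\alpha/\lambda_\alpha)^{\lambda_\alpha}x^\beta : c\in\mathbb{R}_{>0}^A\}$ (both signs). For $\beta\in\mathcal{A}$: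 $E_1(\beta)=\mathbb{R}_+\cdot|x|^\beta$ if $\beta\in\mathcal{A}\setminus\mathcal{B}$, and $E_1(\beta)=\mathbb{R}_+\cdot(|x|^\beta+x^\beta)\cup\mathbb{R}_+\cdot(|x|^\beta-x^\beta)$ if $\beta\in\mathcal{A}\cap\mathcal{B}$. *)

theory Defs
  imports "HOL-Analysis.Analysis" "HOL-Analysis.Finite_Function_Topology"
begin

text \<open>
  An element \<open>\<Sum>\<alpha>. c \<alpha> |x|^\<alpha> + \<Sum>\<beta>. d \<beta> x^\<beta>\<close> is represented by its pair of finitely supported
  coefficient functions \<open>(c, d)\<close>. The real vector space structure is the library's one on
  finitely supported functions and on pairs, i.e. coefficientwise. It cannot be taken pointwise on
  functions with values in \<open>\<real> \<union> {\<infinity>}\<close>: for instance \<open>|x|^\<alpha> + (- |x|^\<alpha>)\<close> is the zero element, also when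
  \<open>|x|^\<alpha>\<close> takes the value \<open>\<infinity>\<close>. As no \<open>\<beta>\<close> under consideration has all entries even, the monomials
  are linearly independent, and the function determines its coefficients.
\<close>

type_synonym 'n signomial = "((real^'n) \<Rightarrow>\<^sub>0 real) \<times> ((nat^'n) \<Rightarrow>\<^sub>0 real)"

definition real_vec :: "nat^'n \<Rightarrow> real^'n" where
  "real_vec \<beta> = (\<chi> j. real (\<beta> $ j))"

text \<open>The case distinction in the product is there because \<open>0 powr 0 = 0\<close> in the library,
  whereas here \<open>|0|^0 = 1\<close>.\<close>

definition abs_power :: "real^'n \<Rightarrow> real^'n \<Rightarrow> ereal" where
  "abs_power x \<alpha> =
     (if \<exists>j. x $ j = 0 \<and> \<alpha> $ j < 0 then \<infinity>
      else ereal (\<Prod>j\<in>UNIV. if \<alpha> $ j = 0 then 1 else \<bar>x $ j\<bar> powr (\<alpha> $ j)))"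

definition nat_power :: "real^'n \<Rightarrow> nat^'n \<Rightarrow> real" where
  "nat_power x \<beta> = (\<Prod>j\<in>UNIV. (x $ j) ^ (\<beta> $ j))"

definition sig_eval :: "'n::finite signomial \<Rightarrow> real^'n \<Rightarrow> ereal" where
  "sig_eval f x =
     (if \<exists>\<alpha>\<in>Poly_Mapping.keys (fst f). abs_power x \<alpha> = \<infinity> then \<infinity>
      else (\<Sum>\<alpha>\<in>Poly_Mapping.keys (fst f). ereal (Poly_Mapping.lookup (fst f) \<alpha>) * abs_power x \<alpha>)
         + ereal (\<Sum>\<beta>\<in>Poly_Mapping.keys (snd f). Poly_Mapping.lookup (snd f) \<beta> * nat_power x \<beta>))"

definition sig_nonneg :: "'n::finite signomial \<Rightarrow> bool" where
  "sig_nonneg f \<longleftrightarrow> (\<forall>x. 0 \<le> sig_eval f x)"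

text \<open>The space \<open>\<real>[\<A>, \<B>]\<close>.\<close>

definition sig_space :: "(real^'n) set \<Rightarrow> (nat^'n) set \<Rightarrow> ('n::finite signomial) set" where
  "sig_space \<A> \<B> = {f. Poly_Mapping.keys (fst f) \<subseteq> \<A> \<and> Poly_Mapping.keys (snd f) \<subseteq> \<B>}"

definition even_AG :: "'n::finite signomial \<Rightarrow> bool" where
  "even_AG f \<longleftrightarrow> card {\<alpha>. Poly_Mapping.lookup (fst f) \<alpha> < 0} \<le> 1 \<and> snd f = 0"

definition odd_AG :: "'n::finite signomial \<Rightarrow> bool" where
  "odd_AG f \<longleftrightarrow> (\<forall>\<alpha>. 0 \<le> Poly_Mapping.lookup (fst f) \<alpha>) \<and> card (Poly_Mapping.keys (snd f)) \<le> 1"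

definition AG :: "'n::finite signomial \<Rightarrow> bool" where
  "AG f \<longleftrightarrow> even_AG f \<or> odd_AG f"

definition S_cone :: "(real^'n) set \<Rightarrow> (nat^'n) set \<Rightarrow> ('n::finite signomial) set" where
  "S_cone \<A> \<B> = convex_cone hull {f \<in> sig_space \<A> \<B>. AG f \<and> sig_nonneg f}"

definition generates_extreme_ray :: "'a::real_vector set \<Rightarrow> 'a \<Rightarrow> bool" where
  "generates_extreme_ray C f \<longleftrightarrow>
     f \<in> C \<and> f \<noteq> 0 \<and>
     (\<forall>gs. set gs \<subseteq> C \<and> f = sum_list gs \<longrightarrow> (\<forall>g\<in>set gs. \<exists>t\<ge>0. g = t *\<^sub>R f))"

definition circuit :: "(real^'n) set \<Rightarrow> real^'n \<Rightarrow> bool" where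
  "circuit A \<beta> \<longleftrightarrow> \<not> affine_dependent A \<and> \<beta> \<in> rel_interior (convex hull A)"

text \<open>The barycentric coordinates \<open>\<lambda>(A, \<beta>)\<close>, extended by \<open>0\<close> outside \<open>A\<close>.\<close>

definition circuit_coeff :: "(real^'n) set \<Rightarrow> real^'n \<Rightarrow> real^'n \<Rightarrow> real" where
  "circuit_coeff A \<beta> =
     (THE l. (\<forall>\<alpha>\<in>A. 0 \<le> l \<alpha>) \<and> (\<forall>\<alpha>. \<alpha> \<notin> A \<longrightarrow> l \<alpha> = 0) \<and>
             (\<Sum>\<alpha>\<in>A. l \<alpha> *\<^sub>R \<alpha>) = \<beta> \<and> (\<Sum>\<alpha>\<in>A. l \<alpha>) = 1)"

definition circuits_even :: "(real^'n) set \<Rightarrow> ((real^'n) set \<times> (real^'n)) set" where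
  "circuits_even \<A> = {(A, \<beta>). A \<subseteq> \<A> \<and> \<beta> \<in> \<A> \<and> circuit A \<beta>}"

definition circuits_odd ::
  "(real^'n) set \<Rightarrow> (nat^'n) set \<Rightarrow> ((real^'n) set \<times> (nat^'n)) set" where
  "circuits_odd \<A> \<B> = {(A, \<beta>). A \<subseteq> \<A> \<and> \<beta> \<in> \<B> \<and> circuit A (real_vec \<beta>)}"

definition r_even :: "(real^'n) set \<Rightarrow> (real^'n) set \<Rightarrow> real^'n \<Rightarrow> nat" where
  "r_even \<A> A \<beta> = card ((convex hull A - (A \<union> {\<beta>})) \<inter> \<A>)"

text \<open>Unlike \<^term>\<open>r_even\<close>, this does not depend on the inner exponent of the circuit.\<close>

definition r_odd :: "(real^'n) set \<Rightarrow> (real^'n) set \<Rightarrow> nat" where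
  "r_odd \<A> A = card ((convex hull A - A) \<inter> \<A>)"

text \<open>The monomials \<open>|x|^\<alpha>\<close> and \<open>x^\<beta>\<close> as elements of the space.\<close>

definition abs_mono :: "real^'n \<Rightarrow> 'n::finite signomial" where
  "abs_mono \<alpha> = (Poly_Mapping.single \<alpha> 1, 0)"

definition nat_mono :: "nat^'n \<Rightarrow> 'n::finite signomial" where
  "nat_mono \<beta> = (0, Poly_Mapping.single \<beta> 1)"

definition circuit_number ::
  "(real^'n) set \<Rightarrow> real^'n \<Rightarrow> (real^'n \<Rightarrow> real) \<Rightarrow> real" where
  "circuit_number A \<beta> c =
     (\<Prod>\<alpha>\<in>A. (c \<alpha> / circuit_coeff A \<beta> \<alpha>) powr (circuit_coeff A \<beta> \<alpha>))"

definition E_even :: "(real^'n) set \<Rightarrow> real^'n \<Rightarrow> ('n::finite signomial) set" where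
  "E_even A \<beta> =
     {(\<Sum>\<alpha>\<in>A. c \<alpha> *\<^sub>R abs_mono \<alpha>) - circuit_number A \<beta> c *\<^sub>R abs_mono \<beta> | c. \<forall>\<alpha>\<in>A. 0 < c \<alpha>}"

definition E_odd :: "(real^'n) set \<Rightarrow> nat^'n \<Rightarrow> ('n::finite signomial) set" where
  "E_odd A \<beta> =
     {(\<Sum>\<alpha>\<in>A. c \<alpha> *\<^sub>R abs_mono \<alpha>) + circuit_number A (real_vec \<beta>) c *\<^sub>R nat_mono \<beta>
        | c. \<forall>\<alpha>\<in>A. 0 < c \<alpha>} \<union>
     {(\<Sum>\<alpha>\<in>A. c \<alpha> *\<^sub>R abs_mono \<alpha>) - circuit_number A (real_vec \<beta>) c *\<^sub>R nat_mono \<beta>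
        | c. \<forall>\<alpha>\<in>A. 0 < c \<alpha>}"

text \<open>As \<^term>\<open>real_vec\<close> is injective, the unions over \<open>\<beta>'\<close> below have a single member.\<close>

definition E_one :: "(nat^'n) set \<Rightarrow> real^'n \<Rightarrow> ('n::finite signomial) set" where
  "E_one \<B> \<beta> =
     (if \<beta> \<notin> real_vec ` \<B> then {t *\<^sub>R abs_mono \<beta> | t. 0 \<le> t}
      else (\<Union>\<beta>'\<in>{\<beta>' \<in> \<B>. real_vec \<beta>' = \<beta>}.
              {t *\<^sub>R (abs_mono \<beta> + nat_mono \<beta>') | t. 0 \<le> t} \<union>
              {t *\<^sub>R (abs_mono \<beta> - nat_mono \<beta>') | t. 0 \<le> t}))"

end

theory Submission
  imports Defs "HOL-Real_Asymp.Real_Asymp"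
begin

text \<open>
  Substituting \<open>x_j = s_j exp w_j\<close> with signs \<open>s_j\<close> turns signomials into sums of exponentials
  \<open>exp (\<alpha> \<bullet> w)\<close>, and non-negativity may be tested on such points
  (\<open>sig_nonneg_iff_torus\<close>). All three possible inner terms \<open>-|x|^\<beta>\<close> and \<open>\<plusminus> x^\<beta>\<close> are bounded below by
  \<open>-|x|^\<beta>\<close> and attain this bound for some \<open>s\<close>. Even and odd AG functions can therefore be treated alike: with
  outer coefficients \<open>c\<close> and inner coefficient \<open>b\<close>, non-negativity means
  \<open>b exp (\<beta> \<bullet> w) \<le> \<Sum>\<alpha>. c \<alpha> exp (\<alpha> \<bullet> w)\<close> for all \<open>w\<close>. For
  \<open>c \<ge> 0\<close>, such a bound holds with equality at \<open>w0\<close> if and only if both sides have the same value and gradient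
  at \<open>w0\<close>, by convexity of the exponential function (\<open>exp_bound_tight_gradient\<close>,
  \<open>exp_bound_if_gradient\<close>).

  An extreme ray is spanned by a single non-negative AG function. Without inner term, this function is a
  monomial. With an inner term, extremality first forbids to split off the terms outside a face of the Newton polytope. Hence
  \<open>w \<mapsto> \<Sum>\<alpha>. c \<alpha> exp ((\<alpha> - \<beta>) \<bullet> w)\<close> attains its minimum, and the vanishing gradient
  there writes \<open>\<beta>\<close> as a convex combination of the outer exponents. By Caratheodory's theorem \<open>\<beta>\<close> lies in the
  relative interior of a simplex spanned by some of them; a small multiple of the circuit function on this
  simplex that vanishes at the minimiser can be split off, so the given function is this circuit function
  (\<open>extreme_ray_imp_circuit\<close>). A further exponent in the simplex would allow to split off another circuit
  function (\<open>extreme_ray_circuit_reduced\<close>).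

  Conversely, a circuit function vanishes at some point, and so do all summands of a decomposition of it. No
  exponent of a summand leaves the simplex (\<open>summand_keys_in_hull\<close>), so that for a reduced circuit only the
  exponents of the circuit remain, and the vanishing gradients determine the coefficients of each summand up to a
  factor (\<open>reduced_circuit_function_extreme\<close>). The rays of \<open>|x|^\<beta> \<plusminus> x^\<beta>\<close> are covered by this
  argument, as circuit functions of the degenerate circuit \<open>({\<beta>}, \<beta>)\<close>.
\<close>

section \<open>Coefficients and values on the torus\<close>

lemma lookup_scaleR [simp]:
  fixes p :: "'a \<Rightarrow>\<^sub>0 'b::real_vector"
  shows "Poly_Mapping.lookup (r *\<^sub>R p) k = r *\<^sub>R Poly_Mapping.lookup p k"
proof -
  have "finite {k. r *\<^sub>R Poly_Mapping.lookup p k \<noteq> 0}"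
    by (rule finite_subset[OF _ finite_lookup[of p]]) auto
  then show ?thesis
    unfolding scaleR_poly_mapping_def by (simp add: Abs_poly_mapping_inverse)
qed

lemma signomial_eqI:
  assumes "\<And>\<alpha>. Poly_Mapping.lookup (fst f) \<alpha> = Poly_Mapping.lookup (fst g) \<alpha>"
    and "\<And>\<beta>. Poly_Mapping.lookup (snd f) \<beta> = Poly_Mapping.lookup (snd g) \<beta>"
  shows "f = (g :: 'n::finite signomial)"
  using assms by (auto simp: prod_eq_iff intro!: poly_mapping_eqI)

text \<open>For a sign vector \<open>s\<close>, this is the value at the point \<open>x\<close> with \<open>x_j = s_j exp w_j\<close>. It is defined for
  arbitrary \<open>s\<close>, as a linear function of the signomial; values in \<open>\<infinity>\<close> do not occur.\<close>

definition torus_eval :: "real^'n \<Rightarrow> real^'n \<Rightarrow> 'n::finite signomial \<Rightarrow> real" where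
  "torus_eval s w f =
     (\<Sum>\<alpha>\<in>Poly_Mapping.keys (fst f). Poly_Mapping.lookup (fst f) \<alpha> * exp (\<alpha> \<bullet> w)) +
     (\<Sum>\<beta>\<in>Poly_Mapping.keys (snd f).
        Poly_Mapping.lookup (snd f) \<beta> * (nat_power s \<beta> * exp (real_vec \<beta> \<bullet> w)))"

definition sign_vecs :: "(real^'n) set" where
  "sign_vecs = {s. \<forall>j. s $ j = 1 \<or> s $ j = -1}"

lemma sum_keys_superset:
  fixes p :: "'a \<Rightarrow>\<^sub>0 real"
  assumes "finite S" and "Poly_Mapping.keys p \<subseteq> S"
  shows "(\<Sum>k\<in>Poly_Mapping.keys p. Poly_Mapping.lookup p k * h k) =
         (\<Sum>k\<in>S. Poly_Mapping.lookup p k * h k)"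
  by (rule sum.mono_neutral_left) (use assms in \<open>auto simp: in_keys_iff\<close>)

lemma torus_eval_superset:
  assumes "finite S" "Poly_Mapping.keys (fst f) \<subseteq> S"
    and "finite T" "Poly_Mapping.keys (snd f) \<subseteq> T"
  shows "torus_eval s w f =
     (\<Sum>\<alpha>\<in>S. Poly_Mapping.lookup (fst f) \<alpha> * exp (\<alpha> \<bullet> w)) +
     (\<Sum>\<beta>\<in>T. Poly_Mapping.lookup (snd f) \<beta> * (nat_power s \<beta> * exp (real_vec \<beta> \<bullet> w)))"
  unfolding torus_eval_def using assms by (simp add: sum_keys_superset)

lemma linear_torus_eval: "linear (torus_eval s w)"
proof (rule linearI)
  fix f g :: "'a signomial"
  let ?S = "Poly_Mapping.keys (fst f) \<union> Poly_Mapping.keys (fst g)"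
  let ?T = "Poly_Mapping.keys (snd f) \<union> Poly_Mapping.keys (snd g)"
  have "Poly_Mapping.keys (fst (f + g)) \<subseteq> ?S" "Poly_Mapping.keys (snd (f + g)) \<subseteq> ?T"
    by (auto simp: in_keys_iff lookup_add)
  then show "torus_eval s w (f + g) = torus_eval s w f + torus_eval s w g"
    by (simp add: torus_eval_superset[where S = ?S and T = ?T] lookup_add ring_distribs sum.distrib)
next
  fix r :: real and f :: "'a signomial"
  have "Poly_Mapping.keys (fst (r *\<^sub>R f)) \<subseteq> Poly_Mapping.keys (fst f)"
    "Poly_Mapping.keys (snd (r *\<^sub>R f)) \<subseteq> Poly_Mapping.keys (snd f)"
    by (auto simp: in_keys_iff)
  then have "torus_eval s w (r *\<^sub>R f) =
     (\<Sum>\<alpha>\<in>Poly_Mapping.keys (fst f). Poly_Mapping.lookup (fst (r *\<^sub>R f)) \<alpha> * exp (\<alpha> \<bullet> w)) +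
     (\<Sum>\<beta>\<in>Poly_Mapping.keys (snd f).
        Poly_Mapping.lookup (snd (r *\<^sub>R f)) \<beta> * (nat_power s \<beta> * exp (real_vec \<beta> \<bullet> w)))"
    by (intro torus_eval_superset) auto
  then show "torus_eval s w (r *\<^sub>R f) = r *\<^sub>R torus_eval s w f"
    by (simp add: torus_eval_def sum_distrib_left ring_distribs mult.assoc)
qed

lemma torus_eval_add: "torus_eval s w (f + g) = torus_eval s w f + torus_eval s w g"
  and torus_eval_minus: "torus_eval s w (- f) = - torus_eval s w f"
  and torus_eval_scaleR: "torus_eval s w (r *\<^sub>R f) = r * torus_eval s w f"
  and torus_eval_sum: "torus_eval s w (\<Sum>i\<in>I. h i) = (\<Sum>i\<in>I. torus_eval s w (h i))"
  using linear_torus_eval[of s w]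
  by (auto simp: linear_add linear_neg linear_cmul linear_sum)

lemma torus_eval_abs_mono: "torus_eval s w (abs_mono \<alpha>) = exp (\<alpha> \<bullet> w)"
  by (simp add: torus_eval_def abs_mono_def)

lemma torus_eval_nat_mono:
  "torus_eval s w (nat_mono \<beta>) = nat_power s \<beta> * exp (real_vec \<beta> \<bullet> w)"
  by (simp add: torus_eval_def nat_mono_def)

lemma nat_power_sign_vec:
  assumes "s \<in> sign_vecs"
  shows "\<bar>nat_power s \<beta>\<bar> = 1"
proof -
  have "\<bar>s $ j\<bar> = 1" for j
    using assms unfolding sign_vecs_def by (metis (mono_tags) abs_1 abs_minus_cancel mem_Collect_eq)
  then show ?thesis
    by (simp add: nat_power_def abs_prod power_abs)
qed

lemma one_in_sign_vecs: "1 \<in> sign_vecs"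
  by (simp add: sign_vecs_def)

lemma nat_power_one_vec: "nat_power 1 \<beta> = 1"
  by (simp add: nat_power_def)

text \<open>Flipping the sign of one coordinate with an odd exponent flips the sign of \<open>x^\<beta>\<close>.\<close>

lemma exists_sign_vec_nat_power:
  fixes \<beta> :: "nat^'n"
  assumes "\<exists>j. odd (\<beta> $ j)" and "r = 1 \<or> r = -1"
  shows "\<exists>s\<in>sign_vecs. nat_power s \<beta> = r"
proof -
  obtain j where j: "odd (\<beta> $ j)" using assms by auto
  define s :: "real^'n" where "s = (\<chi> i. if i = j then -1 else 1)"
  have "nat_power s \<beta> = (\<Prod>i\<in>UNIV. if i = j then (-1) ^ (\<beta> $ i) else 1)"
    unfolding nat_power_def by (intro prod.cong) (auto simp: s_def)
  then have "nat_power s \<beta> = -1"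
    using j by simp
  moreover have "s \<in> sign_vecs"
    by (auto simp: sign_vecs_def s_def)
  ultimately show ?thesis
    using assms(2) one_in_sign_vecs nat_power_one_vec by metis
qed

lemma exp_inner_eq_prod: "exp (\<alpha> \<bullet> w) = (\<Prod>j\<in>UNIV. exp (\<alpha> $ j * w $ j))"
  by (simp add: inner_vec_def exp_sum)

lemma sig_eval_torus:
  assumes s: "s \<in> sign_vecs"
  shows "sig_eval f (\<chi> j. s $ j * exp (w $ j)) = ereal (torus_eval s w f)"
proof -
  let ?x = "(\<chi> j. s $ j * exp (w $ j))"
  have abs1: "\<bar>s $ j\<bar> = 1" for j
    using s unfolding sign_vecs_def by (metis (mono_tags) abs_1 abs_minus_cancel mem_Collect_eq)
  then have nz: "?x $ j \<noteq> 0" for j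
    by (metis abs_zero exp_not_eq_zero mult_eq_0_iff vec_lambda_beta zero_neq_one)
  have abs: "abs_power ?x \<alpha> = ereal (exp (\<alpha> \<bullet> w))" for \<alpha>
  proof -
    have "(if \<alpha> $ j = 0 then 1 else \<bar>?x $ j\<bar> powr (\<alpha> $ j)) = exp (\<alpha> $ j * w $ j)" for j
      by (simp add: abs_mult abs1 powr_def)
    then show ?thesis
      using nz unfolding abs_power_def exp_inner_eq_prod by simp
  qed
  have nat: "nat_power ?x \<beta> = nat_power s \<beta> * exp (real_vec \<beta> \<bullet> w)" for \<beta>
    unfolding exp_inner_eq_prod nat_power_def
    by (simp add: prod.distrib[symmetric] real_vec_def power_mult_distrib exp_of_nat_mult)
  show ?thesis
    unfolding sig_eval_def torus_eval_def by (simp add: abs nat sum_ereal)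
qed

text \<open>Non-negativity needs to be tested on the torus only: a point with vanishing coordinates at which no
  monomial is infinite is a limit of torus points, along which every monomial converges.\<close>

lemma sig_nonneg_iff_torus:
  "sig_nonneg f \<longleftrightarrow> (\<forall>s\<in>sign_vecs. \<forall>w. 0 \<le> torus_eval s w f)"
proof
  assume nonneg: "sig_nonneg f"
  show "\<forall>s\<in>sign_vecs. \<forall>w. 0 \<le> torus_eval s w f"
  proof (intro ballI allI)
    fix s w :: "real^'a"
    assume "s \<in> sign_vecs"
    then show "0 \<le> torus_eval s w f"
      using nonneg sig_eval_torus[of s f w] unfolding sig_nonneg_def
      by (metis ereal_less_eq(3) zero_ereal_def)
  qed
next
  assume nonneg: "\<forall>s\<in>sign_vecs. \<forall>w. 0 \<le> torus_eval s w f"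
  show "sig_nonneg f"
    unfolding sig_nonneg_def
  proof
    fix x :: "real^'a"
    show "0 \<le> sig_eval f x"
    proof (cases "\<exists>\<alpha>\<in>Poly_Mapping.keys (fst f). abs_power x \<alpha> = \<infinity>")
      case True
      then show ?thesis by (simp add: sig_eval_def)
    next
      case False
      define s :: "real^'a" where "s = (\<chi> j. if x $ j < 0 then -1 else 1)"
      define w :: "real \<Rightarrow> real^'a" where "w t = (\<chi> j. if x $ j = 0 then -t else ln \<bar>x $ j\<bar>)" for t
      define a where "a \<alpha> = (\<Prod>j\<in>UNIV. if \<alpha> $ j = 0 then 1 else \<bar>x $ j\<bar> powr (\<alpha> $ j))"
        for \<alpha> :: "real^'a"
      have s: "s \<in> sign_vecs" by (auto simp: s_def sign_vecs_def)
      have neg: "\<alpha> $ j \<ge> 0" if "\<alpha> \<in> Poly_Mapping.keys (fst f)" "x $ j = 0" for \<alpha> j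
        using False that unfolding abs_power_def by (metis linorder_not_le)
      have a: "abs_power x \<alpha> = ereal (a \<alpha>)" if "\<alpha> \<in> Poly_Mapping.keys (fst f)" for \<alpha>
        using neg[OF that] unfolding abs_power_def a_def by (auto simp: not_less[symmetric])
      have lim_abs: "((\<lambda>t. exp (\<alpha> \<bullet> w t)) \<longlongrightarrow> a \<alpha>) at_top"
        if "\<alpha> \<in> Poly_Mapping.keys (fst f)" for \<alpha>
        unfolding exp_inner_eq_prod a_def
      proof (intro tendsto_prod)
        fix j
        show "((\<lambda>t. exp (\<alpha> $ j * w t $ j)) \<longlongrightarrow>
               (if \<alpha> $ j = 0 then 1 else \<bar>x $ j\<bar> powr (\<alpha> $ j))) at_top"
        proof (cases "x $ j = 0 \<and> \<alpha> $ j \<noteq> 0")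
          case True
          then have "\<alpha> $ j > 0" using neg[OF that, of j] by auto
          then have "((\<lambda>t. exp (\<alpha> $ j * - t)) \<longlongrightarrow> 0) at_top"
            by real_asymp
          then show ?thesis using True by (simp add: w_def)
        next
          case False
          then show ?thesis by (auto simp: w_def powr_def)
        qed
      qed
      have lim_nat: "((\<lambda>t. nat_power s \<beta> * exp (real_vec \<beta> \<bullet> w t)) \<longlongrightarrow> nat_power x \<beta>) at_top" for \<beta>
      proof -
        have "((\<lambda>t. s $ j * exp (w t $ j)) \<longlongrightarrow> x $ j) at_top" for j
        proof (cases "x $ j = 0")
          case True
          have "((\<lambda>t::real. exp (- t)) \<longlongrightarrow> 0) at_top" by real_asymp
          then show ?thesis using True by (simp add: w_def s_def)
        next
          case False
          then have "s $ j * exp (w t $ j) = x $ j" for t by (auto simp: w_def s_def)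
          then show ?thesis by simp
        qed
        then have "((\<lambda>t. \<Prod>j\<in>UNIV. (s $ j * exp (w t $ j)) ^ (\<beta> $ j)) \<longlongrightarrow> nat_power x \<beta>) at_top"
          unfolding nat_power_def by (intro tendsto_prod tendsto_power)
        moreover have "(\<Prod>j\<in>UNIV. (s $ j * exp (w t $ j)) ^ (\<beta> $ j)) =
            nat_power s \<beta> * exp (real_vec \<beta> \<bullet> w t)" for t
          unfolding exp_inner_eq_prod nat_power_def
          by (simp add: prod.distrib[symmetric] real_vec_def power_mult_distrib exp_of_nat_mult)
        ultimately show ?thesis by simp
      qed
      let ?L = "(\<Sum>\<alpha>\<in>Poly_Mapping.keys (fst f). Poly_Mapping.lookup (fst f) \<alpha> * a \<alpha>) +
         (\<Sum>\<beta>\<in>Poly_Mapping.keys (snd f). Poly_Mapping.lookup (snd f) \<beta> * nat_power x \<beta>)"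
      have "((\<lambda>t. torus_eval s (w t) f) \<longlongrightarrow> ?L) at_top"
        unfolding torus_eval_def
        by (intro tendsto_add tendsto_sum tendsto_mult[OF tendsto_const] lim_abs lim_nat)
      then have "0 \<le> ?L"
        by (rule tendsto_lowerbound) (use nonneg s in auto)
      moreover have "sig_eval f x = ereal ?L"
        using False a unfolding sig_eval_def by (simp add: sum_ereal)
      ultimately show ?thesis by simp
    qed
  qed
qed

definition posynomial :: "(real^'n) set \<Rightarrow> (real^'n \<Rightarrow> real) \<Rightarrow> 'n::finite signomial" where
  "posynomial A c = (\<Sum>\<alpha>\<in>A. c \<alpha> *\<^sub>R abs_mono \<alpha>)"

text \<open>The inner monomial of an AG function, with its sign, as a signomial. The three kinds of inner monomials
  behave alike, because all of them are bounded below by \<open>-|x|^\<beta>\<close> and attain this bound on some orthant.\<close>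

definition inner_term :: "'n::finite signomial \<Rightarrow> real^'n \<Rightarrow> bool" where
  "inner_term m \<beta> \<longleftrightarrow> m = - abs_mono \<beta> \<or>
     (\<exists>\<beta>'. real_vec \<beta>' = \<beta> \<and> (\<exists>j. odd (\<beta>' $ j)) \<and> (m = nat_mono \<beta>' \<or> m = - nat_mono \<beta>'))"

lemma torus_eval_posynomial: "torus_eval s w (posynomial A c) = (\<Sum>\<alpha>\<in>A. c \<alpha> * exp (\<alpha> \<bullet> w))"
  by (simp add: posynomial_def torus_eval_sum torus_eval_scaleR torus_eval_abs_mono)

lemma lookup_fst_sum:
  "Poly_Mapping.lookup (fst (\<Sum>i\<in>I. h i)) \<alpha> = (\<Sum>i\<in>I. Poly_Mapping.lookup (fst (h i)) \<alpha>)"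
  by (simp add: fst_sum lookup_sum)

lemma lookup_fst_posynomial:
  assumes "finite A"
  shows "Poly_Mapping.lookup (fst (posynomial A c)) \<gamma> = (if \<gamma> \<in> A then c \<gamma> else 0)"
proof -
  have "Poly_Mapping.lookup (fst (posynomial A c)) \<gamma> = (\<Sum>\<alpha>\<in>A. if \<alpha> = \<gamma> then c \<alpha> else 0)"
    unfolding posynomial_def lookup_fst_sum
    by (intro sum.cong) (auto simp: abs_mono_def lookup_single)
  then show ?thesis using assms by simp
qed

lemma snd_posynomial [simp]: "snd (posynomial A c) = 0"
  by (simp add: posynomial_def snd_sum abs_mono_def)

lemma lookup_mono [simp]:
  "Poly_Mapping.lookup (fst (abs_mono \<alpha>)) \<gamma> = (if \<gamma> = \<alpha> then 1 else 0)"
  "snd (abs_mono \<alpha>) = 0"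
  "fst (nat_mono \<beta>) = 0"
  "Poly_Mapping.lookup (snd (nat_mono \<beta>)) \<delta> = (if \<delta> = \<beta> then 1 else 0)"
  by (auto simp: abs_mono_def nat_mono_def lookup_single)

lemma inner_term_lower_bound:
  assumes "inner_term m \<beta>" "s \<in> sign_vecs"
  shows "- exp (\<beta> \<bullet> w) \<le> torus_eval s w m"
proof -
  have "\<bar>nat_power s \<beta>' * exp (real_vec \<beta>' \<bullet> w)\<bar> = exp (real_vec \<beta>' \<bullet> w)" for \<beta>'
    using nat_power_sign_vec[OF assms(2)] by (simp add: abs_mult)
  then have "\<bar>torus_eval s w m\<bar> = exp (\<beta> \<bullet> w)"
    using assms(1) unfolding inner_term_def
    by (auto simp: torus_eval_minus torus_eval_abs_mono torus_eval_nat_mono)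
  then show ?thesis by linarith
qed

lemma inner_term_lower_bound_attained:
  assumes "inner_term m \<beta>"
  shows "\<exists>s\<in>sign_vecs. \<forall>w. torus_eval s w m = - exp (\<beta> \<bullet> w)"
proof -
  consider "m = - abs_mono \<beta>"
    | \<beta>' r where "real_vec \<beta>' = \<beta>" "\<exists>j. odd (\<beta>' $ j)" "m = r *\<^sub>R nat_mono \<beta>'" "r = 1 \<or> r = (-1::real)"
    using assms unfolding inner_term_def by (metis scaleR_minus1_left scaleR_one)
  then show ?thesis
  proof cases
    case 1
    then show ?thesis
      using one_in_sign_vecs by (auto simp: torus_eval_minus torus_eval_abs_mono)
  next
    case 2
    then obtain s where "s \<in> sign_vecs" "nat_power s \<beta>' = - r"
      using exists_sign_vec_nat_power[of \<beta>' "- r"] by auto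
    then show ?thesis
      using 2(1,3,4) by (intro bexI[of _ s]) (auto simp: torus_eval_scaleR torus_eval_nat_mono)
  qed
qed

lemma sig_nonneg_iff_exp_bound:
  assumes "inner_term m \<beta>" and "0 \<le> b"
  shows "sig_nonneg (posynomial A c + b *\<^sub>R m) \<longleftrightarrow>
    (\<forall>w. b * exp (\<beta> \<bullet> w) \<le> (\<Sum>\<alpha>\<in>A. c \<alpha> * exp (\<alpha> \<bullet> w)))"
proof
  assume nonneg: "sig_nonneg (posynomial A c + b *\<^sub>R m)"
  obtain s where s: "s \<in> sign_vecs" "\<And>w. torus_eval s w m = - exp (\<beta> \<bullet> w)"
    using inner_term_lower_bound_attained[OF assms(1)] by auto
  show "\<forall>w. b * exp (\<beta> \<bullet> w) \<le> (\<Sum>\<alpha>\<in>A. c \<alpha> * exp (\<alpha> \<bullet> w))"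
  proof
    fix w
    have "0 \<le> torus_eval s w (posynomial A c + b *\<^sub>R m)"
      using nonneg s(1) unfolding sig_nonneg_iff_torus by blast
    then show "b * exp (\<beta> \<bullet> w) \<le> (\<Sum>\<alpha>\<in>A. c \<alpha> * exp (\<alpha> \<bullet> w))"
      by (simp add: torus_eval_add torus_eval_scaleR torus_eval_posynomial s(2))
  qed
next
  assume bound: "\<forall>w. b * exp (\<beta> \<bullet> w) \<le> (\<Sum>\<alpha>\<in>A. c \<alpha> * exp (\<alpha> \<bullet> w))"
  show "sig_nonneg (posynomial A c + b *\<^sub>R m)"
    unfolding sig_nonneg_iff_torus
  proof (intro ballI allI)
    fix s w :: "real^'a"
    assume "s \<in> sign_vecs"
    then have "b * - exp (\<beta> \<bullet> w) \<le> b * torus_eval s w m"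
      using inner_term_lower_bound[OF assms(1)] assms(2) by (intro mult_left_mono)
    then show "0 \<le> torus_eval s w (posynomial A c + b *\<^sub>R m)"
      using bound[rule_format, of w]
      by (simp add: torus_eval_add torus_eval_scaleR torus_eval_posynomial)
  qed
qed


section \<open>Sums of exponentials\<close>

text \<open>The difference of the two sides has a minimum at \<open>w0\<close>, so its gradient vanishes there.\<close>

lemma exp_bound_tight_gradient:
  fixes A :: "'a::euclidean_space set"
  assumes bound: "\<And>w. b * exp (\<beta> \<bullet> w) \<le> (\<Sum>\<alpha>\<in>A. c \<alpha> * exp (\<alpha> \<bullet> w))"
    and tight: "b * exp (\<beta> \<bullet> w0) = (\<Sum>\<alpha>\<in>A. c \<alpha> * exp (\<alpha> \<bullet> w0))"
  shows "(\<Sum>\<alpha>\<in>A. (c \<alpha> * exp (\<alpha> \<bullet> w0)) *\<^sub>R \<alpha>) = (b * exp (\<beta> \<bullet> w0)) *\<^sub>R \<beta>"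
proof -
  \<comment> \<open>The gradient itself serves as the direction in which to differentiate.\<close>
  define u where "u = (\<Sum>\<alpha>\<in>A. (c \<alpha> * exp (\<alpha> \<bullet> w0)) *\<^sub>R \<alpha>) - (b * exp (\<beta> \<bullet> w0)) *\<^sub>R \<beta>"
  define \<phi> where "\<phi> t = (\<Sum>\<alpha>\<in>A. c \<alpha> * exp (\<alpha> \<bullet> w0 + t * (\<alpha> \<bullet> u))) - b * exp (\<beta> \<bullet> w0 + t * (\<beta> \<bullet> u))"
    for t :: real
  have deriv: "(\<phi> has_real_derivative (\<Sum>\<alpha>\<in>A. c \<alpha> * (exp (\<alpha> \<bullet> w0) * (\<alpha> \<bullet> u))) - b * (exp (\<beta> \<bullet> w0) * (\<beta> \<bullet> u))) (at 0)"
    unfolding \<phi>_def by (auto intro!: derivative_eq_intros sum.cong simp: mult_ac)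
  have "\<phi> 0 \<le> \<phi> t" for t
    using bound[of "w0 + t *\<^sub>R u"] tight by (simp add: \<phi>_def inner_add_right)
  then have "(\<Sum>\<alpha>\<in>A. c \<alpha> * (exp (\<alpha> \<bullet> w0) * (\<alpha> \<bullet> u))) - b * (exp (\<beta> \<bullet> w0) * (\<beta> \<bullet> u)) = 0"
    by (intro DERIV_local_min[OF deriv, of 1]) auto
  moreover have "u \<bullet> u = (\<Sum>\<alpha>\<in>A. (c \<alpha> * exp (\<alpha> \<bullet> w0)) *\<^sub>R \<alpha>) \<bullet> u - ((b * exp (\<beta> \<bullet> w0)) *\<^sub>R \<beta>) \<bullet> u"
    by (metis u_def inner_diff_left)
  ultimately have "u \<bullet> u = 0"
    by (simp add: inner_sum_left mult.assoc)
  then show ?thesis by (simp add: u_def)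
qed

text \<open>The converse: tangency at a single point suffices, by \<open>exp x \<ge> 1 + x\<close>. This is the weighted
  inequality between arithmetic and geometric means.\<close>

lemma exp_bound_if_gradient:
  fixes A :: "'a::euclidean_space set"
  assumes c: "\<And>\<alpha>. \<alpha> \<in> A \<Longrightarrow> 0 \<le> c \<alpha>"
    and grad: "(\<Sum>\<alpha>\<in>A. (c \<alpha> * exp (\<alpha> \<bullet> w0)) *\<^sub>R \<alpha>) = (b * exp (\<beta> \<bullet> w0)) *\<^sub>R \<beta>"
    and tight: "(\<Sum>\<alpha>\<in>A. c \<alpha> * exp (\<alpha> \<bullet> w0)) = b * exp (\<beta> \<bullet> w0)"
  shows "b * exp (\<beta> \<bullet> w) \<le> (\<Sum>\<alpha>\<in>A. c \<alpha> * exp (\<alpha> \<bullet> w))"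
proof -
  let ?\<nu> = "\<lambda>\<alpha>. c \<alpha> * exp (\<alpha> \<bullet> w0)"
  let ?e = "exp (\<beta> \<bullet> (w - w0))"
  have "(\<Sum>\<alpha>\<in>A. ?\<nu> \<alpha> * ((\<alpha> - \<beta>) \<bullet> (w - w0))) =
      ((\<Sum>\<alpha>\<in>A. ?\<nu> \<alpha> *\<^sub>R \<alpha>) - (\<Sum>\<alpha>\<in>A. ?\<nu> \<alpha>) *\<^sub>R \<beta>) \<bullet> (w - w0)"
    by (simp add: inner_diff_left inner_sum_left sum_subtractf right_diff_distrib sum_distrib_right)
  then have zero: "(\<Sum>\<alpha>\<in>A. ?\<nu> \<alpha> * ((\<alpha> - \<beta>) \<bullet> (w - w0))) = 0"
    by (simp add: grad tight)
  have "b * exp (\<beta> \<bullet> w) = ?e * (b * exp (\<beta> \<bullet> w0))"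
    by (simp add: inner_diff_right exp_diff)
  also have "\<dots> = ?e * (\<Sum>\<alpha>\<in>A. ?\<nu> \<alpha> * (1 + (\<alpha> - \<beta>) \<bullet> (w - w0)))"
    by (simp add: distrib_left sum.distrib zero tight)
  also have "\<dots> \<le> ?e * (\<Sum>\<alpha>\<in>A. ?\<nu> \<alpha> * exp ((\<alpha> - \<beta>) \<bullet> (w - w0)))"
    using c by (intro mult_left_mono sum_mono) (auto intro: exp_ge_add_one_self)
  also have "\<dots> = (\<Sum>\<alpha>\<in>A. c \<alpha> * exp (\<alpha> \<bullet> w))"
    unfolding sum_distrib_left
    by (intro sum.cong) (auto simp: exp_diff inner_diff_left inner_diff_right)
  finally show ?thesis .
qed

text \<open>Going to infinity in a direction \<open>v\<close> in which no exponent of the right-hand side grows faster than \<open>\<beta>\<close>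
  removes all terms that grow strictly slower.\<close>

lemma exp_bound_face:
  fixes A :: "'a::euclidean_space set"
  assumes A: "finite A"
    and bound: "\<And>w. b * exp (\<beta> \<bullet> w) \<le> (\<Sum>\<alpha>\<in>A. c \<alpha> * exp (\<alpha> \<bullet> w))"
    and v: "\<And>\<alpha>. \<alpha> \<in> A \<Longrightarrow> (\<alpha> - \<beta>) \<bullet> v \<le> 0"
  shows "b * exp (\<beta> \<bullet> w) \<le> (\<Sum>\<alpha>\<in>{\<alpha> \<in> A. (\<alpha> - \<beta>) \<bullet> v = 0}. c \<alpha> * exp (\<alpha> \<bullet> w))"
proof -
  have "((\<lambda>t. \<Sum>\<alpha>\<in>A. c \<alpha> * exp (\<alpha> \<bullet> w) * exp (t * ((\<alpha> - \<beta>) \<bullet> v))) \<longlongrightarrow>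
      (\<Sum>\<alpha>\<in>A. c \<alpha> * exp (\<alpha> \<bullet> w) * (if (\<alpha> - \<beta>) \<bullet> v = 0 then 1 else 0))) at_top"
  proof (intro tendsto_sum tendsto_mult[OF tendsto_const])
    fix \<alpha> assume "\<alpha> \<in> A"
    show "((\<lambda>t. exp (t * ((\<alpha> - \<beta>) \<bullet> v))) \<longlongrightarrow> (if (\<alpha> - \<beta>) \<bullet> v = 0 then 1 else 0)) at_top"
    proof (cases "(\<alpha> - \<beta>) \<bullet> v = 0")
      case False
      then have "(\<alpha> - \<beta>) \<bullet> v < 0" using v[OF \<open>\<alpha> \<in> A\<close>] by simp
      then have "((\<lambda>t. exp (t * ((\<alpha> - \<beta>) \<bullet> v))) \<longlongrightarrow> 0) at_top" by real_asymp
      then show ?thesis using False by simp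
    qed simp
  qed
  moreover have "b * exp (\<beta> \<bullet> w) \<le> (\<Sum>\<alpha>\<in>A. c \<alpha> * exp (\<alpha> \<bullet> w) * exp (t * ((\<alpha> - \<beta>) \<bullet> v)))" for t
  proof -
    have "b * exp (\<beta> \<bullet> w) = b * exp (\<beta> \<bullet> (w + t *\<^sub>R v)) * exp (- (t * (\<beta> \<bullet> v)))"
      by (simp add: inner_add_right exp_add exp_minus)
    also have "\<dots> \<le> (\<Sum>\<alpha>\<in>A. c \<alpha> * exp (\<alpha> \<bullet> (w + t *\<^sub>R v))) * exp (- (t * (\<beta> \<bullet> v)))"
      using bound by (intro mult_right_mono) auto
    also have "\<dots> = (\<Sum>\<alpha>\<in>A. c \<alpha> * exp (\<alpha> \<bullet> w) * exp (t * ((\<alpha> - \<beta>) \<bullet> v)))"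
      unfolding sum_distrib_right
      by (intro sum.cong)
        (simp_all add: inner_add_right inner_diff_left right_diff_distrib exp_add exp_diff exp_minus divide_inverse)
    finally show ?thesis .
  qed
  ultimately have "b * exp (\<beta> \<bullet> w) \<le>
      (\<Sum>\<alpha>\<in>A. c \<alpha> * exp (\<alpha> \<bullet> w) * (if (\<alpha> - \<beta>) \<bullet> v = 0 then 1 else 0))"
    by (intro tendsto_lowerbound[where F = "at_top :: real filter"]) auto
  also have "\<dots> = (\<Sum>\<alpha>\<in>{\<alpha> \<in> A. (\<alpha> - \<beta>) \<bullet> v = 0}. c \<alpha> * exp (\<alpha> \<bullet> w))"
    using A by (intro sum.mono_neutral_cong_right) auto
  finally show ?thesis .
qed

text \<open>In a direction that separates \<open>\<beta>\<close> from the other exponents, the left-hand side would win.\<close>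

lemma exp_bound_imp_convex_hull:
  fixes A :: "'a::euclidean_space set"
  assumes A: "finite A" and b: "0 < b"
    and bound: "\<And>w. b * exp (\<beta> \<bullet> w) \<le> (\<Sum>\<alpha>\<in>A. c \<alpha> * exp (\<alpha> \<bullet> w))"
  shows "\<beta> \<in> convex hull A"
proof (rule ccontr)
  assume "\<beta> \<notin> convex hull A"
  then obtain v r where v: "v \<bullet> \<beta> < r" "\<forall>x\<in>convex hull A. r < v \<bullet> x"
    using separating_hyperplane_closed_point[of "convex hull A" \<beta>] A
    by (auto simp: finite_imp_compact_convex_hull compact_imp_closed)
  then have v': "(\<alpha> - \<beta>) \<bullet> (- v) < 0" if "\<alpha> \<in> A" for \<alpha>
  proof -
    have "r < v \<bullet> \<alpha>" using v(2) hull_inc[OF that, of convex] by blast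
    then show ?thesis using v(1) by (simp add: inner_diff_right inner_commute)
  qed
  then have empty: "{\<alpha> \<in> A. (\<alpha> - \<beta>) \<bullet> (- v) = 0} = {}"
    by force
  have "b * exp (\<beta> \<bullet> 0) \<le> (\<Sum>\<alpha>\<in>{\<alpha> \<in> A. (\<alpha> - \<beta>) \<bullet> (- v) = 0}. c \<alpha> * exp (\<alpha> \<bullet> 0))"
    using v' by (intro exp_bound_face[OF A bound]) force
  then show False
    using b unfolding empty by simp
qed

text \<open>The hypothesis on the exponents says that the sum grows in every direction in which it is not constant.
  On the span of the exponents it is therefore coercive: since \<open>exp x \<ge> max 0 x\<close>, it dominates a
  positively homogeneous function that is positive on the unit sphere.\<close>

lemma exp_sum_attains_min:
  fixes E :: "'a::euclidean_space set"
  assumes E: "finite E" and c: "\<And>\<alpha>. \<alpha> \<in> E \<Longrightarrow> 0 < c \<alpha>"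
    and grow: "\<And>v. (\<And>\<alpha>. \<alpha> \<in> E \<Longrightarrow> \<alpha> \<bullet> v \<le> 0) \<Longrightarrow> (\<And>\<alpha>. \<alpha> \<in> E \<Longrightarrow> \<alpha> \<bullet> v = 0)"
  shows "\<exists>w0. \<forall>w. (\<Sum>\<alpha>\<in>E. c \<alpha> * exp (\<alpha> \<bullet> w0)) \<le> (\<Sum>\<alpha>\<in>E. c \<alpha> * exp (\<alpha> \<bullet> w))"
proof -
  define g where "g w = (\<Sum>\<alpha>\<in>E. c \<alpha> * exp (\<alpha> \<bullet> w))" for w
  define h where "h v = (\<Sum>\<alpha>\<in>E. c \<alpha> * max 0 (\<alpha> \<bullet> v))" for v
  have h_pos: "0 < h v" if "v \<in> span E" "v \<noteq> 0" for v
  proof -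
    have "\<exists>\<alpha>\<in>E. \<alpha> \<bullet> v \<noteq> 0"
    proof (rule ccontr)
      assume "\<not> (\<exists>\<alpha>\<in>E. \<alpha> \<bullet> v \<noteq> 0)"
      then have "orthogonal v \<alpha>" if "\<alpha> \<in> E" for \<alpha>
        using that by (simp add: orthogonal_def inner_commute)
      then have "orthogonal v v"
        using orthogonal_to_span[OF that(1)] by blast
      then show False using that(2) by (simp add: orthogonal_def)
    qed
    then obtain \<alpha> where \<alpha>: "\<alpha> \<in> E" "\<alpha> \<bullet> v > 0"
      using grow[of v] by (metis linorder_not_le)
    have "0 < c \<alpha> * max 0 (\<alpha> \<bullet> v)" using c[OF \<alpha>(1)] \<alpha>(2) by simp
    moreover have "0 \<le> c \<gamma> * max 0 (\<gamma> \<bullet> v)" if "\<gamma> \<in> E" for \<gamma> using c[OF that] by simp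
    ultimately show ?thesis
      unfolding h_def using E \<alpha>(1) by (intro sum_pos2[where i = \<alpha>]) auto
  qed
  have h_scale: "h (r *\<^sub>R v) = r * h v" if "0 \<le> r" for r v
  proof -
    have "max 0 (r * y) = r * max 0 y" for y :: real
      using that by (auto simp: max_def mult_le_0_iff zero_le_mult_iff)
    then show ?thesis
      by (simp add: h_def sum_distrib_left mult.left_commute)
  qed
  have gh: "h w \<le> g w" for w
    unfolding g_def h_def
  proof (intro sum_mono mult_left_mono)
    fix \<alpha> show "max 0 (\<alpha> \<bullet> w) \<le> exp (\<alpha> \<bullet> w)"
      using exp_ge_add_one_self[of "\<alpha> \<bullet> w"] exp_gt_zero[of "\<alpha> \<bullet> w"] by linarith
  qed (use c in force)
  have "\<exists>\<delta>>0. \<forall>v\<in>span E \<inter> sphere 0 1. \<delta> \<le> h v"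
  proof (cases "span E \<inter> sphere (0::'a) 1 = {}")
    case False
    have "compact (span E \<inter> sphere (0::'a) 1)"
      by (intro closed_Int_compact closed_subspace) auto
    moreover have "continuous_on (span E \<inter> sphere 0 1) h"
      unfolding h_def by (intro continuous_intros)
    ultimately obtain v where "v \<in> span E \<inter> sphere 0 1" "\<forall>y\<in>span E \<inter> sphere 0 1. h v \<le> h y"
      using continuous_attains_inf[of "span E \<inter> sphere 0 1" h] False by blast
    moreover from this have "0 < h v" by (intro h_pos) auto
    ultimately show ?thesis by blast
  qed (auto intro: exI[of _ 1])
  then obtain \<delta> where \<delta>: "\<delta> > 0" "\<And>v. v \<in> span E \<Longrightarrow> norm v = 1 \<Longrightarrow> \<delta> \<le> h v"
    by auto
  have coercive: "\<delta> * norm w \<le> g w" if "w \<in> span E" for w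
  proof (cases "w = 0")
    case True
    then show ?thesis using c by (simp add: g_def sum_nonneg less_imp_le)
  next
    case False
    have "\<delta> \<le> h (inverse (norm w) *\<^sub>R w)"
      using that False by (intro \<delta>(2)) (auto intro: span_scale)
    then have "\<delta> * norm w \<le> h w"
      using False by (simp add: h_scale field_simps)
    then show ?thesis using gh[of w] by linarith
  qed
  define R where "R = g 0 / \<delta>"
  have "0 \<le> g 0"
    using c by (simp add: g_def sum_nonneg less_imp_le)
  then have "0 \<in> span E \<inter> cball 0 R"
    using \<delta>(1) by (simp add: R_def span_zero)
  moreover have "compact (span E \<inter> cball 0 R)"
    by (intro closed_Int_compact closed_subspace) auto
  moreover have "continuous_on (span E \<inter> cball 0 R) g"
    unfolding g_def by (intro continuous_intros)
  ultimately obtain w0 where w0: "w0 \<in> span E" "\<And>w. w \<in> span E \<inter> cball 0 R \<Longrightarrow> g w0 \<le> g w"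
    using continuous_attains_inf[of "span E \<inter> cball 0 R" g] by blast
  have "g w0 \<le> g w" for w
  proof -
    obtain y z where yz: "y \<in> span E" "\<And>u. u \<in> span E \<Longrightarrow> orthogonal z u" "w = y + z"
      using orthogonal_subspace_decomp_exists[of E w] by metis
    have "\<alpha> \<bullet> w = \<alpha> \<bullet> y" if "\<alpha> \<in> E" for \<alpha>
      using yz(2)[OF span_base[OF that]] by (simp add: yz(3) inner_add_right orthogonal_def inner_commute)
    then have "g w = g y" by (simp add: g_def)
    moreover have "g w0 \<le> g y"
    proof (cases "norm y \<le> R")
      case True
      then show ?thesis using w0(2)[of y] yz(1) by simp
    next
      case False
      then have "g 0 \<le> \<delta> * norm y" using \<delta>(1) by (simp add: R_def field_simps)
      then have "g 0 \<le> g y" using coercive[OF yz(1)] by linarith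
      moreover have "g w0 \<le> g 0" using w0(2)[of 0] \<open>0 \<in> span E \<inter> cball 0 R\<close> by blast
      ultimately show ?thesis by linarith
    qed
    ultimately show ?thesis by simp
  qed
  then show ?thesis unfolding g_def by blast
qed

section \<open>Circuits\<close>

text \<open>Caratheodory's theorem, for a subset of minimal cardinality: minimality makes the subset affinely
  independent and all barycentric coordinates positive.\<close>

lemma convex_hull_rel_interior_simplex:
  fixes P :: "'a::euclidean_space set"
  assumes "finite P" and "\<beta> \<in> convex hull P"
  obtains A where "A \<subseteq> P" "\<not> affine_dependent A" "\<beta> \<in> rel_interior (convex hull A)"
proof -
  define A where "A = arg_min card (\<lambda>A. A \<subseteq> P \<and> \<beta> \<in> convex hull A)"
  have A: "A \<subseteq> P" "\<beta> \<in> convex hull A"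
    using arg_min_natI[of "\<lambda>A. A \<subseteq> P \<and> \<beta> \<in> convex hull A" P card] assms(2) by (auto simp: A_def)
  have min: "card A \<le> card S" if "S \<subseteq> P" "\<beta> \<in> convex hull S" for S
    using arg_min_nat_le[of "\<lambda>A. A \<subseteq> P \<and> \<beta> \<in> convex hull A" S card] that by (simp add: A_def)
  have fin: "finite A" using A(1) assms(1) finite_subset by blast
  obtain S where "S \<subseteq> A" "int (card S) \<le> aff_dim A + 1" "\<beta> \<in> convex hull S"
    using A(2) caratheodory_aff_dim[of A] by auto
  then have "int (card A) \<le> aff_dim A + 1"
    using min[of S] A(1) by force
  moreover have "aff_dim A \<le> int (card A) - 1"
    using aff_dim_le_card[OF fin] .
  ultimately have indep: "\<not> affine_dependent A"
    using fin by (simp add: affine_independent_iff_card)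
  obtain u where u: "\<forall>x\<in>A. 0 \<le> u x" "sum u A = 1" "(\<Sum>x\<in>A. u x *\<^sub>R x) = \<beta>"
    using A(2) unfolding convex_hull_finite[OF fin] by auto
  have "0 < u a" if a: "a \<in> A" for a
  proof (rule ccontr)
    assume "\<not> 0 < u a"
    then have "u a = 0" using u(1) a by force
    then have "sum u (A - {a}) = 1" "(\<Sum>x\<in>A - {a}. u x *\<^sub>R x) = \<beta>"
      using u fin a by (auto simp: sum_diff1)
    then have "\<beta> \<in> convex hull (A - {a})"
      using u(1) fin by (auto simp: convex_hull_finite)
    then show False
      using min[of "A - {a}"] A(1) a fin by (metis Diff_subset card_Diff1_less dual_order.trans linorder_not_le)
  qed
  then have "\<beta> \<in> rel_interior (convex hull A)"
    unfolding rel_interior_convex_hull_explicit[OF indep] using u by auto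
  then show ?thesis using that A(1) indep by blast
qed

lemma affine_independent_coeff_unique:
  fixes A :: "'a::euclidean_space set"
  assumes "\<not> affine_dependent A" and "sum u A = sum v A"
    and "(\<Sum>\<alpha>\<in>A. u \<alpha> *\<^sub>R \<alpha>) = (\<Sum>\<alpha>\<in>A. v \<alpha> *\<^sub>R \<alpha>)" and "\<alpha> \<in> A"
  shows "u \<alpha> = v \<alpha>"
proof (rule ccontr)
  assume "u \<alpha> \<noteq> v \<alpha>"
  moreover have "(\<Sum>\<alpha>\<in>A. u \<alpha> - v \<alpha>) = 0" "(\<Sum>\<alpha>\<in>A. (u \<alpha> - v \<alpha>) *\<^sub>R \<alpha>) = 0"
    using assms(2,3) by (simp_all add: sum_subtractf scaleR_diff_left)
  ultimately have "affine_dependent A"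
    unfolding affine_dependent_explicit_finite[OF aff_independent_finite[OF assms(1)]]
    using assms(4) by (intro exI[of _ "\<lambda>\<alpha>. u \<alpha> - v \<alpha>"]) auto
  then show False using assms(1) by simp
qed

lemma circuit_coeff:
  fixes \<beta> :: "real^'n::finite"
  assumes "circuit A \<beta>"
  shows circuit_coeff_pos: "\<And>\<alpha>. \<alpha> \<in> A \<Longrightarrow> 0 < circuit_coeff A \<beta> \<alpha>"
    and circuit_coeff_sum: "sum (circuit_coeff A \<beta>) A = 1"
    and circuit_coeff_barycenter: "(\<Sum>\<alpha>\<in>A. circuit_coeff A \<beta> \<alpha> *\<^sub>R \<alpha>) = \<beta>"
proof -
  have indep: "\<not> affine_dependent A" using assms by (simp add: circuit_def)
  obtain u where u: "\<forall>x\<in>A. 0 < u x" "sum u A = 1" "(\<Sum>x\<in>A. u x *\<^sub>R x) = \<beta>"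
    using assms rel_interior_convex_hull_explicit[OF indep] by (auto simp: circuit_def)
  have "circuit_coeff A \<beta> = (\<lambda>\<alpha>. if \<alpha> \<in> A then u \<alpha> else 0)"
    unfolding circuit_coeff_def
  proof (rule the_equality)
    fix l
    assume l: "(\<forall>\<alpha>\<in>A. 0 \<le> l \<alpha>) \<and> (\<forall>\<alpha>. \<alpha> \<notin> A \<longrightarrow> l \<alpha> = 0) \<and>
             (\<Sum>\<alpha>\<in>A. l \<alpha> *\<^sub>R \<alpha>) = \<beta> \<and> (\<Sum>\<alpha>\<in>A. l \<alpha>) = 1"
    then show "l = (\<lambda>\<alpha>. if \<alpha> \<in> A then u \<alpha> else 0)"
      using affine_independent_coeff_unique[OF indep, of l u] u by auto
  qed (use u in \<open>auto simp: less_imp_le\<close>)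
  then show "\<And>\<alpha>. \<alpha> \<in> A \<Longrightarrow> 0 < circuit_coeff A \<beta> \<alpha>" "sum (circuit_coeff A \<beta>) A = 1"
    "(\<Sum>\<alpha>\<in>A. circuit_coeff A \<beta> \<alpha> *\<^sub>R \<alpha>) = \<beta>"
    using u by auto
qed

lemma circuit_coeff_unique:
  fixes \<beta> :: "real^'n::finite"
  assumes "circuit A \<beta>" and "sum \<nu> A = D" and "(\<Sum>\<alpha>\<in>A. \<nu> \<alpha> *\<^sub>R \<alpha>) = D *\<^sub>R \<beta>" and "\<alpha> \<in> A"
  shows "\<nu> \<alpha> = D * circuit_coeff A \<beta> \<alpha>"
proof (rule affine_independent_coeff_unique[OF _ _ _ assms(4)])
  show "\<not> affine_dependent A" using assms(1) by (simp add: circuit_def)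
  show "sum \<nu> A = (\<Sum>\<alpha>\<in>A. D * circuit_coeff A \<beta> \<alpha>)"
    using circuit_coeff_sum[OF assms(1)] assms(2) by (simp add: sum_distrib_left[symmetric])
  have "(\<Sum>\<alpha>\<in>A. (D * circuit_coeff A \<beta> \<alpha>) *\<^sub>R \<alpha>) = D *\<^sub>R (\<Sum>\<alpha>\<in>A. circuit_coeff A \<beta> \<alpha> *\<^sub>R \<alpha>)"
    by (simp add: scaleR_sum_right)
  then show "(\<Sum>\<alpha>\<in>A. \<nu> \<alpha> *\<^sub>R \<alpha>) = (\<Sum>\<alpha>\<in>A. (D * circuit_coeff A \<beta> \<alpha>) *\<^sub>R \<alpha>)"
    using circuit_coeff_barycenter[OF assms(1)] assms(3) by simp
qed

text \<open>A vertex of a simplex lies in the relative interior only if the simplex is a point.\<close>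

lemma circuit_eq_singleton:
  fixes \<beta> :: "real^'n::finite"
  assumes "circuit A \<beta>" and "\<beta> \<in> A"
  shows "A = {\<beta>}"
proof -
  have fin: "finite A" using assms(1) by (simp add: circuit_def aff_independent_finite)
  have "(\<Sum>\<alpha>\<in>A. (if \<alpha> = \<beta> then 1 else 0) *\<^sub>R \<alpha>) = (\<Sum>\<alpha>\<in>A. if \<alpha> = \<beta> then \<beta> else 0)"
    by (intro sum.cong) auto
  then have "(if \<alpha> = \<beta> then 1 else 0) = 1 * circuit_coeff A \<beta> \<alpha>" if "\<alpha> \<in> A" for \<alpha>
    using assms fin that by (intro circuit_coeff_unique) auto
  then have "\<alpha> = \<beta>" if "\<alpha> \<in> A" for \<alpha>
    using circuit_coeff_pos[OF assms(1) that] that by (cases "\<alpha> = \<beta>") fastforce+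
  then show ?thesis using assms(2) by blast
qed

lemma circuit_singleton: "circuit {\<beta>} \<beta>"
  by (simp add: circuit_def)

text \<open>An affine function takes prescribed values on an affinely independent set. This yields the zero of a
  circuit function, whose coordinates solve such a linear system after taking logarithms.\<close>

lemma affine_independent_interpolation:
  fixes A :: "'a::euclidean_space set"
  assumes "\<not> affine_dependent A"
  shows "\<exists>w r. \<forall>\<alpha>\<in>A. \<alpha> \<bullet> w + r = h \<alpha>"
proof (cases "A = {}")
  case False
  then obtain a where a: "a \<in> A" by blast
  then have "independent ((\<lambda>x. - a + x) ` (A - {a}))"
    using assms affine_dependent_iff_dependent2 by blast
  from linear_independent_extend[OF this, of "\<lambda>x. h (x + a) - h a"]
  obtain g :: "'a \<Rightarrow> real" where g: "linear g"
    "\<forall>x\<in>(\<lambda>x. - a + x) ` (A - {a}). g x = h (x + a) - h a" by blast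
  have adj: "g x = x \<bullet> adjoint g 1" for x
    using adjoint_works[OF g(1), of x 1] by simp
  have "\<alpha> \<bullet> adjoint g 1 + (h a - a \<bullet> adjoint g 1) = h \<alpha>" if "\<alpha> \<in> A" for \<alpha>
  proof (cases "\<alpha> = a")
    case False
    then have "g (- a + \<alpha>) = h \<alpha> - h a" using g(2) that by auto
    then show ?thesis by (simp add: adj inner_diff_left)
  qed simp
  then show ?thesis by blast
qed simp


section \<open>The cone and its generators\<close>

definition nonneg_AG :: "(real^'n) set \<Rightarrow> (nat^'n) set \<Rightarrow> ('n::finite signomial) set" where
  "nonneg_AG \<A> \<B> = {f \<in> sig_space \<A> \<B>. AG f \<and> sig_nonneg f}"

lemma sig_space_iff_lookup:
  "f \<in> sig_space \<A> \<B> \<longleftrightarrow> (\<forall>\<alpha>. \<alpha> \<notin> \<A> \<longrightarrow> Poly_Mapping.lookup (fst f) \<alpha> = 0) \<and>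
    (\<forall>\<beta>. \<beta> \<notin> \<B> \<longrightarrow> Poly_Mapping.lookup (snd f) \<beta> = 0)"
  unfolding sig_space_def subset_iff in_keys_iff by blast

lemma nonneg_AG_scaleR:
  assumes "f \<in> nonneg_AG \<A> \<B>" and "0 \<le> r"
  shows "r *\<^sub>R f \<in> nonneg_AG \<A> \<B>"
proof -
  have "r *\<^sub>R f \<in> sig_space \<A> \<B>"
    using assms(1) by (simp add: nonneg_AG_def sig_space_iff_lookup)
  moreover have "sig_nonneg (r *\<^sub>R f)"
    using assms by (simp add: nonneg_AG_def sig_nonneg_iff_torus torus_eval_scaleR)
  moreover have "AG (r *\<^sub>R f)"
  proof (cases "r = 0")
    case True
    then show ?thesis by (simp add: AG_def even_AG_def)
  next
    case False
    then have r: "0 < r" using assms(2) by simp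
    then have "Poly_Mapping.keys (snd (r *\<^sub>R f)) = Poly_Mapping.keys (snd f)"
      by (auto simp: in_keys_iff)
    then show ?thesis
      using assms(1) r unfolding nonneg_AG_def AG_def even_AG_def odd_AG_def
      by (auto simp: mult_less_0_iff zero_le_mult_iff)
  qed
  ultimately show ?thesis by (simp add: nonneg_AG_def)
qed

text \<open>Coefficients in front of the generators are unnecessary, because the non-negative AG functions are
  closed under scaling.\<close>

lemma S_cone_eq_sums: "S_cone \<A> \<B> = {sum_list gs | gs. set gs \<subseteq> nonneg_AG \<A> \<B>}"
  (is "_ = ?T")
proof
  have zero: "0 \<in> ?T" by (intro CollectI exI[of _ "[]"]) auto
  have add: "x + y \<in> ?T" if xy: "x \<in> ?T" "y \<in> ?T" for x y
  proof -
    obtain xs ys where "x = sum_list xs" "y = sum_list ys"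
      "set xs \<subseteq> nonneg_AG \<A> \<B>" "set ys \<subseteq> nonneg_AG \<A> \<B>" using xy by blast
    then show ?thesis by (intro CollectI exI[of _ "xs @ ys"]) auto
  qed
  have scale: "r *\<^sub>R x \<in> ?T" if x: "x \<in> ?T" and r: "0 \<le> r" for x r
  proof -
    obtain xs where xs: "x = sum_list xs" "set xs \<subseteq> nonneg_AG \<A> \<B>" using x by blast
    have "r *\<^sub>R x = sum_list (map (\<lambda>g. r *\<^sub>R g) xs)"
      unfolding xs(1) by (induction xs) (auto simp: scaleR_add_right)
    moreover have "set (map (\<lambda>g. r *\<^sub>R g) xs) \<subseteq> nonneg_AG \<A> \<B>"
      using xs(2) nonneg_AG_scaleR[OF _ r] unfolding set_map by blast
    ultimately show ?thesis by blast
  qed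
  have "convex_cone ?T"
    unfolding convex_cone_iff using zero add scale by blast
  moreover have "nonneg_AG \<A> \<B> \<subseteq> ?T"
  proof
    fix g assume "g \<in> nonneg_AG \<A> \<B>"
    then show "g \<in> ?T" by (intro CollectI exI[of _ "[g]"]) auto
  qed
  ultimately show "S_cone \<A> \<B> \<subseteq> ?T"
    unfolding S_cone_def nonneg_AG_def[symmetric] by (intro hull_minimal)
next
  show "?T \<subseteq> S_cone \<A> \<B>"
  proof
    fix f assume "f \<in> ?T"
    then obtain gs where gs: "f = sum_list gs" "set gs \<subseteq> nonneg_AG \<A> \<B>" by blast
    show "f \<in> S_cone \<A> \<B>"
      using gs(2) unfolding gs(1) S_cone_def nonneg_AG_def[symmetric]
      by (induction gs) (simp_all add: convex_cone_hull_contains_0 convex_cone_hull_add hull_inc)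
  qed
qed

lemma nonneg_AG_subset_S_cone: "nonneg_AG \<A> \<B> \<subseteq> S_cone \<A> \<B>"
  unfolding S_cone_def nonneg_AG_def[symmetric] by (rule hull_subset)

text \<open>Extremality needs to be tested on decompositions into generators only.\<close>

lemma generates_extreme_ray_if_generators:
  assumes "f \<in> nonneg_AG \<A> \<B>" and "f \<noteq> 0"
    and gen: "\<And>gs g. set gs \<subseteq> nonneg_AG \<A> \<B> \<Longrightarrow> f = sum_list gs \<Longrightarrow> g \<in> set gs \<Longrightarrow> \<exists>t\<ge>0. g = t *\<^sub>R f"
  shows "generates_extreme_ray (S_cone \<A> \<B>) f"
  unfolding generates_extreme_ray_def
proof (intro conjI allI impI ballI)
  show "f \<in> S_cone \<A> \<B>" using assms(1) nonneg_AG_subset_S_cone by blast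
  show "f \<noteq> 0" by fact
  fix gs g
  assume gs: "set gs \<subseteq> S_cone \<A> \<B> \<and> f = sum_list gs" and g: "g \<in> set gs"
  have "\<forall>g\<in>S_cone \<A> \<B>. \<exists>hs. set hs \<subseteq> nonneg_AG \<A> \<B> \<and> g = sum_list hs"
    unfolding S_cone_eq_sums by blast
  then obtain H where H: "\<And>g. g \<in> S_cone \<A> \<B> \<Longrightarrow> set (H g) \<subseteq> nonneg_AG \<A> \<B> \<and> g = sum_list (H g)"
    by metis
  have "\<forall>g\<in>set gs. sum_list (H g) = g"
    using gs H by (metis subsetD)
  then have "sum_list (concat (map H gs)) = sum_list gs"
    by (induction gs) auto
  moreover have "set (concat (map H gs)) \<subseteq> nonneg_AG \<A> \<B>"
    using gs H unfolding set_concat set_map by blast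
  ultimately have "\<exists>t\<ge>0. h = t *\<^sub>R f" if "h \<in> set (H g)" for h
    using gen[of "concat (map H gs)" h] gs g that unfolding set_concat set_map by (metis UN_I imageI)
  then have "\<exists>t\<ge>0. sum_list hs = t *\<^sub>R f" if "set hs \<subseteq> set (H g)" for hs
    using that
  proof (induction hs)
    case Nil
    show ?case by (intro exI[of _ 0]) simp
  next
    case (Cons h hs)
    obtain t where t: "t \<ge> 0" "h = t *\<^sub>R f"
      using Cons.prems \<open>\<And>h. h \<in> set (H g) \<Longrightarrow> \<exists>t\<ge>0. h = t *\<^sub>R f\<close>[of h] by (meson list.set_intros(1) subsetD)
    obtain u where u: "u \<ge> 0" "sum_list hs = u *\<^sub>R f"
      using Cons.IH Cons.prems by (meson set_subset_Cons subset_trans)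
    have "sum_list (h # hs) = (t + u) *\<^sub>R f"
      using t(2) u(2) by (simp add: scaleR_add_left)
    then show ?case using t(1) u(1) by (intro exI[of _ "t + u"] conjI) auto
  qed
  then show "\<exists>t\<ge>0. g = t *\<^sub>R f"
    using H[of g] gs g by (metis order_refl subsetD)
qed

lemma extreme_ray_in_nonneg_AG:
  assumes "generates_extreme_ray (S_cone \<A> \<B>) f"
  shows "f \<in> nonneg_AG \<A> \<B>"
proof -
  have f: "f \<in> S_cone \<A> \<B>" "f \<noteq> 0"
    and ext: "\<And>gs g. set gs \<subseteq> S_cone \<A> \<B> \<Longrightarrow> f = sum_list gs \<Longrightarrow> g \<in> set gs \<Longrightarrow> \<exists>t\<ge>0. g = t *\<^sub>R f"
    using assms unfolding generates_extreme_ray_def by blast+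
  obtain gs where gs: "set gs \<subseteq> nonneg_AG \<A> \<B>" "f = sum_list gs"
    using f(1) unfolding S_cone_eq_sums by auto
  have "\<exists>g\<in>set gs. g \<noteq> 0"
  proof (rule ccontr)
    assume "\<not> (\<exists>g\<in>set gs. g \<noteq> 0)"
    then have "sum_list gs = 0" by (induction gs) auto
    then show False using f(2) gs(2) by simp
  qed
  then obtain g where g: "g \<in> set gs" "g \<noteq> 0" by blast
  then obtain t where t: "t \<ge> 0" "g = t *\<^sub>R f"
    using ext[of gs g] gs nonneg_AG_subset_S_cone by blast
  then have "t > 0" using g(2) by (cases "t = 0") auto
  then have "f = inverse t *\<^sub>R g" using t(2) by simp
  then show ?thesis
    using nonneg_AG_scaleR[of g \<A> \<B> "inverse t"] g(1) gs(1) \<open>t > 0\<close> by auto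
qed

lemma extreme_ray_summand:
  assumes "generates_extreme_ray (S_cone \<A> \<B>) f" and "f = g + h"
    and "g \<in> nonneg_AG \<A> \<B>" and "h \<in> nonneg_AG \<A> \<B>"
  shows "\<exists>t\<ge>0. g = t *\<^sub>R f"
proof -
  have "set [g, h] \<subseteq> S_cone \<A> \<B> \<and> f = sum_list [g, h]"
    using assms nonneg_AG_subset_S_cone by auto
  then show ?thesis
    using assms(1) unfolding generates_extreme_ray_def by (metis list.set_intros(1))
qed

lemma posynomial_inner_in_nonneg_AG:
  assumes A: "finite A" "A \<subseteq> \<A>" and c: "\<And>\<alpha>. \<alpha> \<in> A \<Longrightarrow> 0 \<le> c \<alpha>"
    and b: "0 \<le> b" and m: "inner_term m \<beta>" "m \<in> sig_space \<A> \<B>"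
    and bound: "\<And>w. b * exp (\<beta> \<bullet> w) \<le> (\<Sum>\<alpha>\<in>A. c \<alpha> * exp (\<alpha> \<bullet> w))"
  shows "posynomial A c + b *\<^sub>R m \<in> nonneg_AG \<A> \<B>"
proof -
  let ?f = "posynomial A c + b *\<^sub>R m"
  have space: "?f \<in> sig_space \<A> \<B>"
    using A m(2) by (auto simp: sig_space_iff_lookup lookup_add lookup_fst_posynomial)
  have nonneg: "sig_nonneg ?f"
    using sig_nonneg_iff_exp_bound[OF m(1) b] bound by blast
  consider "m = - abs_mono \<beta>" | \<beta>' r where "m = r *\<^sub>R nat_mono \<beta>'"
    using m(1) unfolding inner_term_def by (metis scaleR_minus1_left scaleR_one)
  then have "AG ?f"
  proof cases
    case 1
    have "0 \<le> Poly_Mapping.lookup (fst ?f) \<alpha>" if "\<alpha> \<noteq> \<beta>" for \<alpha>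
      using that c[of \<alpha>] A(1) by (simp add: 1 lookup_add lookup_minus lookup_fst_posynomial)
    then have "{\<alpha>. Poly_Mapping.lookup (fst ?f) \<alpha> < 0} \<subseteq> {\<beta>}"
      by (force simp: not_less)
    then have "card {\<alpha>. Poly_Mapping.lookup (fst ?f) \<alpha> < 0} \<le> 1"
      using card_mono[of "{\<beta>}"] by simp
    then show ?thesis by (simp add: AG_def even_AG_def 1)
  next
    case 2
    have "Poly_Mapping.keys (snd ?f) \<subseteq> {\<beta>'}"
      by (auto simp: 2 in_keys_iff split: if_splits)
    then have "card (Poly_Mapping.keys (snd ?f)) \<le> 1"
      using card_mono[of "{\<beta>'}"] by simp
    moreover have "\<forall>\<alpha>. 0 \<le> Poly_Mapping.lookup (fst ?f) \<alpha>"
      using c A(1) by (auto simp: 2 lookup_add lookup_fst_posynomial)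
    ultimately show ?thesis by (simp add: AG_def odd_AG_def)
  qed
  then show ?thesis using space nonneg by (simp add: nonneg_AG_def)
qed

lemma posynomial_in_nonneg_AG:
  assumes "finite A" "A \<subseteq> \<A>" and c: "\<And>\<alpha>. \<alpha> \<in> A \<Longrightarrow> 0 \<le> c \<alpha>"
  shows "posynomial A c \<in> nonneg_AG \<A> \<B>"
proof -
  have "posynomial A c \<in> sig_space \<A> \<B>"
    using assms by (auto simp: sig_space_iff_lookup lookup_fst_posynomial)
  moreover have "AG (posynomial A c)"
    using assms by (auto simp: AG_def odd_AG_def lookup_fst_posynomial)
  moreover have "sig_nonneg (posynomial A c)"
    unfolding sig_nonneg_iff_torus torus_eval_posynomial using c by (auto intro!: sum_nonneg)
  ultimately show ?thesis by (simp add: nonneg_AG_def)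
qed

definition pos_keys :: "'n::finite signomial \<Rightarrow> (real^'n) set" where
  "pos_keys f = {\<alpha>. 0 < Poly_Mapping.lookup (fst f) \<alpha>}"

lemma finite_pos_keys: "finite (pos_keys f)"
  by (rule finite_subset[of _ "Poly_Mapping.keys (fst f)"]) (auto simp: pos_keys_def in_keys_iff)

lemma lookup_fst_posynomial_pos_keys:
  "Poly_Mapping.lookup (fst (posynomial (pos_keys f) c)) \<alpha> =
    (if 0 < Poly_Mapping.lookup (fst f) \<alpha> then c \<alpha> else 0)"
  by (simp add: lookup_fst_posynomial[OF finite_pos_keys]) (simp add: pos_keys_def)

text \<open>The last conclusion is restricted to the even case, because an odd AG function may have \<open>|x|^\<beta>\<close> among its
  outer terms.\<close>

lemma AG_normal_form:
  assumes \<B>: "\<forall>\<beta>\<in>\<B>. \<not> (\<forall>j. even (\<beta> $ j))" and f: "f \<in> nonneg_AG \<A> \<B>"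
  obtains "f = posynomial (pos_keys f) (Poly_Mapping.lookup (fst f))"
  | b m \<beta> where "f = posynomial (pos_keys f) (Poly_Mapping.lookup (fst f)) + b *\<^sub>R m" "0 < b"
      "inner_term m \<beta>" "m \<in> sig_space \<A> \<B>" "m = - abs_mono \<beta> \<Longrightarrow> \<beta> \<notin> pos_keys f"
proof -
  let ?c = "Poly_Mapping.lookup (fst f)" and ?d = "Poly_Mapping.lookup (snd f)"
  let ?N = "{\<alpha>. ?c \<alpha> < 0}"
  have space: "Poly_Mapping.keys (fst f) \<subseteq> \<A>" "Poly_Mapping.keys (snd f) \<subseteq> \<B>"
    using f by (auto simp: nonneg_AG_def sig_space_def)
  have "finite ?N"
    by (rule finite_subset[of _ "Poly_Mapping.keys (fst f)"]) (auto simp: in_keys_iff)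
  consider "?N = {}" "snd f = 0" | \<beta> where "?N = {\<beta>}" "snd f = 0"
    | \<beta>' where "?N = {}" "Poly_Mapping.keys (snd f) = {\<beta>'}"
  proof -
    have "AG f" using f by (simp add: nonneg_AG_def)
    then consider "card ?N \<le> 1" "snd f = 0"
      | "\<forall>\<alpha>. 0 \<le> ?c \<alpha>" "card (Poly_Mapping.keys (snd f)) \<le> 1"
      by (auto simp: AG_def even_AG_def odd_AG_def)
    then show thesis
    proof cases
      case 1
      then have "card ?N = 0 \<or> card ?N = 1" by auto
      then show thesis using that(1,2) 1(2) \<open>finite ?N\<close> by (metis card_0_eq card_1_singletonE)
    next
      case 2
      then have "?N = {}" by (simp add: not_less)
      moreover have "card (Poly_Mapping.keys (snd f)) = 0 \<or> card (Poly_Mapping.keys (snd f)) = 1"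
        using 2(2) by linarith
      then have "Poly_Mapping.keys (snd f) = {} \<or> (\<exists>\<beta>'. Poly_Mapping.keys (snd f) = {\<beta>'})"
        by (metis card_0_eq card_1_singletonE finite_keys)
      then have "snd f = 0 \<or> (\<exists>\<beta>'. Poly_Mapping.keys (snd f) = {\<beta>'})"
        by simp
      ultimately show thesis using that(1,3) by blast
    qed
  qed
  then show thesis
  proof cases
    case 1
    then have pos: "\<And>\<alpha>. 0 \<le> ?c \<alpha>" by (auto simp: not_less)
    have "f = posynomial (pos_keys f) ?c"
    proof (rule signomial_eqI)
      show "?c \<alpha> = Poly_Mapping.lookup (fst (posynomial (pos_keys f) ?c)) \<alpha>" for \<alpha>
        using pos[of \<alpha>] by (simp add: lookup_fst_posynomial_pos_keys)
    qed (simp add: 1(2))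
    then show thesis by (rule that(1))
  next
    case 2
    have N: "?c \<alpha> < 0 \<longleftrightarrow> \<alpha> = \<beta>" for \<alpha>
      using arg_cong[OF 2(1), of "\<lambda>N. \<alpha> \<in> N"] by simp
    have neg: "?c \<beta> < 0" "\<And>\<alpha>. \<alpha> \<noteq> \<beta> \<Longrightarrow> 0 \<le> ?c \<alpha>"
      using N by (simp, metis N linorder_not_le)
    show thesis
    proof (rule that(2))
      show "f = posynomial (pos_keys f) ?c + (- ?c \<beta>) *\<^sub>R (- abs_mono \<beta>)"
      proof (rule signomial_eqI)
        fix \<alpha>
        show "?c \<alpha> = Poly_Mapping.lookup (fst (posynomial (pos_keys f) ?c + (- ?c \<beta>) *\<^sub>R (- abs_mono \<beta>))) \<alpha>"
          using neg(1) neg(2)[of \<alpha>]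
          by (cases "\<alpha> = \<beta>") (simp_all add: lookup_fst_posynomial_pos_keys lookup_add)
      qed (simp add: 2(2))
      show "0 < - ?c \<beta>" "\<beta> \<notin> pos_keys f" using neg by (auto simp: pos_keys_def)
      show "inner_term (- abs_mono \<beta>) \<beta>" by (simp add: inner_term_def)
      have "\<beta> \<in> \<A>" using neg(1) space(1) by (auto simp: in_keys_iff)
      then show "- abs_mono \<beta> \<in> sig_space \<A> \<B>"
        by (auto simp: sig_space_iff_lookup)
    qed
  next
    case 3
    then have pos: "\<And>\<alpha>. 0 \<le> ?c \<alpha>" by (auto simp: not_less)
    have D: "?d \<beta> \<noteq> 0 \<longleftrightarrow> \<beta> = \<beta>'" for \<beta>
      using arg_cong[OF 3(2), of "\<lambda>N. \<beta> \<in> N"] by (simp add: in_keys_iff)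
    then have d: "?d \<beta>' \<noteq> 0" "\<And>\<beta>. \<beta> \<noteq> \<beta>' \<Longrightarrow> ?d \<beta> = 0" by (simp, metis D)
    have "\<beta>' \<in> \<B>" using 3(2) space(2) by simp
    then have odd: "\<exists>j. odd (\<beta>' $ j)" using \<B> by blast
    show thesis
    proof (rule that(2))
      show "f = posynomial (pos_keys f) ?c + \<bar>?d \<beta>'\<bar> *\<^sub>R (sgn (?d \<beta>') *\<^sub>R nat_mono \<beta>')"
      proof (rule signomial_eqI)
        fix \<alpha>
        show "?c \<alpha> = Poly_Mapping.lookup
            (fst (posynomial (pos_keys f) ?c + \<bar>?d \<beta>'\<bar> *\<^sub>R (sgn (?d \<beta>') *\<^sub>R nat_mono \<beta>'))) \<alpha>"
          using pos[of \<alpha>] by (simp add: lookup_fst_posynomial_pos_keys)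
      next
        fix \<beta>
        show "?d \<beta> = Poly_Mapping.lookup
            (snd (posynomial (pos_keys f) ?c + \<bar>?d \<beta>'\<bar> *\<^sub>R (sgn (?d \<beta>') *\<^sub>R nat_mono \<beta>'))) \<beta>"
          using d(2)[of \<beta>] by (simp add: abs_mult_sgn mult.commute)
      qed
      show "0 < \<bar>?d \<beta>'\<bar>" using d(1) by simp
      show "inner_term (sgn (?d \<beta>') *\<^sub>R nat_mono \<beta>') (real_vec \<beta>')"
        using odd d(1) unfolding inner_term_def by (cases "?d \<beta>' > 0") auto
      show "sgn (?d \<beta>') *\<^sub>R nat_mono \<beta>' \<in> sig_space \<A> \<B>"
        using \<open>\<beta>' \<in> \<B>\<close> by (auto simp: sig_space_iff_lookup)
      assume "sgn (?d \<beta>') *\<^sub>R nat_mono \<beta>' = - abs_mono (real_vec \<beta>')"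
      then have "Poly_Mapping.lookup (fst (sgn (?d \<beta>') *\<^sub>R nat_mono \<beta>')) (real_vec \<beta>') =
          Poly_Mapping.lookup (fst (- abs_mono (real_vec \<beta>'))) (real_vec \<beta>')" by (rule arg_cong)
      then show "real_vec \<beta>' \<notin> pos_keys f" by simp
    qed
  qed
qed

text \<open>Uniqueness of the representation, as far as it is needed: the inner coefficient is determined because
  either no other summand contributes to \<open>|x|^\<beta>\<close>, or \<open>m\<close> is the only summand in the odd part.\<close>

lemma normal_form_unique:
  assumes eq: "posynomial P c + b *\<^sub>R m = posynomial Q d + r *\<^sub>R m" and "inner_term m \<beta>"
    and fin: "finite P" "finite Q" and m: "m = - abs_mono \<beta> \<Longrightarrow> \<beta> \<notin> P \<union> Q"
  shows "b = r" and "\<And>\<alpha>. (if \<alpha> \<in> P then c \<alpha> else 0) = (if \<alpha> \<in> Q then d \<alpha> else 0)"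
proof -
  have l: "Poly_Mapping.lookup (fst (posynomial P c + b *\<^sub>R m)) \<alpha> =
      Poly_Mapping.lookup (fst (posynomial Q d + r *\<^sub>R m)) \<alpha>"
    "Poly_Mapping.lookup (snd (posynomial P c + b *\<^sub>R m)) \<gamma> =
      Poly_Mapping.lookup (snd (posynomial Q d + r *\<^sub>R m)) \<gamma>" for \<alpha> \<gamma>
    using eq by simp_all
  consider "m = - abs_mono \<beta>" | \<beta>' where "m = nat_mono \<beta>' \<or> m = - nat_mono \<beta>'"
    using assms(2) unfolding inner_term_def by blast
  then show "b = r"
  proof cases
    case 1
    then show ?thesis using l(1)[of \<beta>] m fin by (simp add: lookup_minus lookup_fst_posynomial)
  next
    case 2
    then show ?thesis using l(2)[of \<beta>'] by auto
  qed
  then have "posynomial P c = posynomial Q d" using eq by simp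
  then show "(if \<alpha> \<in> P then c \<alpha> else 0) = (if \<alpha> \<in> Q then d \<alpha> else 0)" for \<alpha>
    using lookup_fst_posynomial[OF fin(1), of c \<alpha>] lookup_fst_posynomial[OF fin(2), of d \<alpha>] by simp
qed

lemma posynomial_scaleR: "t *\<^sub>R posynomial P c = posynomial P (\<lambda>\<alpha>. t * c \<alpha>)"
  by (simp add: posynomial_def scaleR_sum_right)

lemma posynomial_add: "posynomial P c + posynomial P d = posynomial P (\<lambda>\<alpha>. c \<alpha> + d \<alpha>)"
  by (simp add: posynomial_def sum.distrib scaleR_add_left)


section \<open>Circuit numbers\<close>

text \<open>A circuit function touches zero at \<open>w0\<close> precisely if its outer terms are there in the ratio of the
  barycentric coordinates. The circuit number is the inner coefficient for which this happens.\<close>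

lemma circuit_number_eq_if_tight:
  fixes \<beta> :: "real^'n::finite"
  assumes circ: "circuit A \<beta>" and b: "0 < b"
    and tight: "\<And>\<alpha>. \<alpha> \<in> A \<Longrightarrow> c \<alpha> * exp (\<alpha> \<bullet> w0) = b * circuit_coeff A \<beta> \<alpha> * exp (\<beta> \<bullet> w0)"
  shows "circuit_number A \<beta> c = b"
proof -
  let ?l = "circuit_coeff A \<beta>"
  have fin: "finite A" using circ by (simp add: circuit_def aff_independent_finite)
  have "(c \<alpha> / ?l \<alpha>) powr ?l \<alpha> = exp (?l \<alpha> * ln b + ?l \<alpha> * ((\<beta> - \<alpha>) \<bullet> w0))" if "\<alpha> \<in> A" for \<alpha>
  proof -
    have "c \<alpha> / ?l \<alpha> = b * exp ((\<beta> - \<alpha>) \<bullet> w0)"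
      using tight[OF that] circuit_coeff_pos[OF circ that]
      by (simp add: inner_diff_left exp_diff field_simps)
    then show ?thesis using b by (simp add: powr_def ln_mult distrib_left)
  qed
  then have "circuit_number A \<beta> c = exp (\<Sum>\<alpha>\<in>A. ?l \<alpha> * ln b + ?l \<alpha> * ((\<beta> - \<alpha>) \<bullet> w0))"
    by (simp add: circuit_number_def exp_sum[OF fin])
  also have "(\<Sum>\<alpha>\<in>A. ?l \<alpha> * ln b + ?l \<alpha> * ((\<beta> - \<alpha>) \<bullet> w0)) =
      sum ?l A * ln b + (sum ?l A *\<^sub>R \<beta> - (\<Sum>\<alpha>\<in>A. ?l \<alpha> *\<^sub>R \<alpha>)) \<bullet> w0"
    by (simp add: sum.distrib sum_distrib_right inner_diff_left inner_sum_left sum_subtractf right_diff_distrib)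
  also have "\<dots> = ln b"
    using circuit_coeff_sum[OF circ] circuit_coeff_barycenter[OF circ] by simp
  finally show ?thesis using b by simp
qed

lemma circuit_number_tight_point:
  fixes \<beta> :: "real^'n::finite"
  assumes circ: "circuit A \<beta>" and c: "\<And>\<alpha>. \<alpha> \<in> A \<Longrightarrow> 0 < c \<alpha>"
  obtains w0 where "0 < circuit_number A \<beta> c"
    "\<And>\<alpha>. \<alpha> \<in> A \<Longrightarrow> c \<alpha> * exp (\<alpha> \<bullet> w0) =
      circuit_number A \<beta> c * circuit_coeff A \<beta> \<alpha> * exp (\<beta> \<bullet> w0)"
proof -
  let ?l = "circuit_coeff A \<beta>"
  have "\<not> affine_dependent A" using circ by (simp add: circuit_def)
  from affine_independent_interpolation[OF this, of "\<lambda>\<alpha>. ln (?l \<alpha> / c \<alpha>)"]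
  obtain w r where wr: "\<forall>\<alpha>\<in>A. \<alpha> \<bullet> w + r = ln (?l \<alpha> / c \<alpha>)" by blast
  define b where "b = exp (- r - \<beta> \<bullet> w)"
  have tight: "c \<alpha> * exp (\<alpha> \<bullet> w) = b * ?l \<alpha> * exp (\<beta> \<bullet> w)" if "\<alpha> \<in> A" for \<alpha>
  proof -
    have "exp (\<alpha> \<bullet> w + r) = ?l \<alpha> / c \<alpha>"
      using wr that c[OF that] circuit_coeff_pos[OF circ that] by simp
    then show ?thesis
      using c[OF that] by (simp add: b_def exp_add exp_diff exp_minus field_simps)
  qed
  moreover have "circuit_number A \<beta> c = b"
    by (rule circuit_number_eq_if_tight[OF circ _ tight]) (simp_all add: b_def)
  ultimately show ?thesis using that[of w] by (simp add: b_def)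
qed

text \<open>At \<open>w0\<close> both sides have the same value and gradient, because the weights are barycentric coordinates.\<close>

lemma circuit_bound:
  fixes \<beta> :: "real^'n::finite"
  assumes circ: "circuit A \<beta>" and c: "\<And>\<alpha>. \<alpha> \<in> A \<Longrightarrow> 0 \<le> c \<alpha>"
    and tight: "\<And>\<alpha>. \<alpha> \<in> A \<Longrightarrow> c \<alpha> * exp (\<alpha> \<bullet> w0) = b * circuit_coeff A \<beta> \<alpha> * exp (\<beta> \<bullet> w0)"
  shows "b * exp (\<beta> \<bullet> w) \<le> (\<Sum>\<alpha>\<in>A. c \<alpha> * exp (\<alpha> \<bullet> w))"
proof (rule exp_bound_if_gradient[OF c])
  let ?l = "circuit_coeff A \<beta>"
  have "(\<Sum>\<alpha>\<in>A. (c \<alpha> * exp (\<alpha> \<bullet> w0)) *\<^sub>R \<alpha>) = (b * exp (\<beta> \<bullet> w0)) *\<^sub>R (\<Sum>\<alpha>\<in>A. ?l \<alpha> *\<^sub>R \<alpha>)"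
    unfolding scaleR_sum_right by (intro sum.cong) (auto simp: tight mult_ac)
  then show "(\<Sum>\<alpha>\<in>A. (c \<alpha> * exp (\<alpha> \<bullet> w0)) *\<^sub>R \<alpha>) = (b * exp (\<beta> \<bullet> w0)) *\<^sub>R \<beta>"
    by (simp add: circuit_coeff_barycenter[OF circ])
  have "(\<Sum>\<alpha>\<in>A. c \<alpha> * exp (\<alpha> \<bullet> w0)) = (b * exp (\<beta> \<bullet> w0)) * sum ?l A"
    unfolding sum_distrib_left by (intro sum.cong) (auto simp: tight mult_ac)
  then show "(\<Sum>\<alpha>\<in>A. c \<alpha> * exp (\<alpha> \<bullet> w0)) = b * exp (\<beta> \<bullet> w0)"
    by (simp add: circuit_coeff_sum[OF circ])
qed

lemma circuit_card_gt_one: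
  fixes \<beta> :: "real^'n::finite"
  assumes "circuit A \<beta>" and "\<beta> \<notin> A"
  shows "card A > 1"
proof (rule ccontr)
  assume "\<not> card A > 1"
  then have "card A = 0 \<or> card A = 1" by linarith
  moreover have "finite A" using assms(1) by (simp add: circuit_def aff_independent_finite)
  ultimately have "A = {} \<or> (\<exists>a. A = {a})"
    by (metis card_0_eq card_1_singletonE)
  then show False using assms by (auto simp: circuit_def)
qed

section \<open>Extreme rays are reduced circuit functions\<close>

text \<open>A posynomial that splits off is a multiple of the whole function, but it lacks the inner term; so the
  factor is zero.\<close>

lemma extreme_ray_posynomial_part_zero:
  assumes ext: "generates_extreme_ray (S_cone \<A> \<B>) (posynomial P c + b *\<^sub>R m)"
    and P: "finite P" and b: "0 < b"
    and m: "inner_term m \<beta>" "m = - abs_mono \<beta> \<Longrightarrow> \<beta> \<notin> P"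
    and Q: "Q \<subseteq> P" "posynomial Q d \<in> nonneg_AG \<A> \<B>"
    and rest: "posynomial P c + b *\<^sub>R m = posynomial Q d + h" "h \<in> nonneg_AG \<A> \<B>"
    and \<alpha>: "\<alpha> \<in> Q"
  shows "d \<alpha> = 0"
proof -
  have fin: "finite Q" using Q(1) P finite_subset by blast
  obtain t where "posynomial Q d = t *\<^sub>R (posynomial P c + b *\<^sub>R m)"
    using extreme_ray_summand[OF ext rest(1) Q(2) rest(2)] by blast
  then have eq: "posynomial Q d + 0 *\<^sub>R m = posynomial P (\<lambda>\<alpha>. t * c \<alpha>) + (t * b) *\<^sub>R m"
    by (simp add: scaleR_add_right posynomial_scaleR)
  have "m = - abs_mono \<beta> \<Longrightarrow> \<beta> \<notin> Q \<union> P" using m(2) Q(1) by blast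
  note unique = normal_form_unique[OF eq m(1) fin P this]
  have "t = 0" using unique(1) b by simp
  then show ?thesis using unique(2)[of \<alpha>] \<alpha> by simp
qed

text \<open>The idea is to find a circuit function that can be split off. It is built around a minimiser \<open>w0\<close> of the
  quotient of the outer terms by \<open>|x|^\<beta>\<close>: a function with inner term that is non-negative because of
  \<open>exp_bound_if_gradient\<close> at \<open>w0\<close> stays so when another one of the same kind is subtracted, as long as its
  coefficients keep their signs.\<close>

lemma extreme_ray_imp_circuit:
  assumes ext: "generates_extreme_ray (S_cone \<A> \<B>) (posynomial P c + b *\<^sub>R m)"
    and P: "finite P" "P \<subseteq> \<A>" and c: "\<And>\<alpha>. \<alpha> \<in> P \<Longrightarrow> 0 < c \<alpha>" and b: "0 < b"
    and m: "inner_term m \<beta>" "m \<in> sig_space \<A> \<B>" "m = - abs_mono \<beta> \<Longrightarrow> \<beta> \<notin> P"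
  obtains w0 where "circuit P \<beta>"
    "\<And>\<alpha>. \<alpha> \<in> P \<Longrightarrow> c \<alpha> * exp (\<alpha> \<bullet> w0) = b * circuit_coeff P \<beta> \<alpha> * exp (\<beta> \<bullet> w0)"
proof -
  let ?f = "posynomial P c + b *\<^sub>R m"
  have bound: "b * exp (\<beta> \<bullet> w) \<le> (\<Sum>\<alpha>\<in>P. c \<alpha> * exp (\<alpha> \<bullet> w))" for w
    using extreme_ray_in_nonneg_AG[OF ext] sig_nonneg_iff_exp_bound[OF m(1), of b P c] b
    by (simp add: nonneg_AG_def)
  note zero = extreme_ray_posynomial_part_zero[OF ext P(1) b m(1,3)]
  \<comment> \<open>Otherwise the terms off a proper face could be split off as a posynomial.\<close>
  have face: "(\<alpha> - \<beta>) \<bullet> v = 0" if v: "\<And>\<alpha>. \<alpha> \<in> P \<Longrightarrow> (\<alpha> - \<beta>) \<bullet> v \<le> 0" and \<alpha>: "\<alpha> \<in> P" for v \<alpha>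
  proof (rule ccontr)
    assume neq: "(\<alpha> - \<beta>) \<bullet> v \<noteq> 0"
    let ?F = "{\<alpha> \<in> P. (\<alpha> - \<beta>) \<bullet> v = 0}"
    have "posynomial P c = posynomial (P - ?F) c + posynomial ?F c"
      unfolding posynomial_def using P(1) by (intro sum.subset_diff) auto
    then have eq: "?f = posynomial (P - ?F) c + (posynomial ?F c + b *\<^sub>R m)" by simp
    have "posynomial ?F c + b *\<^sub>R m \<in> nonneg_AG \<A> \<B>"
      using P c b m exp_bound_face[OF P(1) bound v]
      by (intro posynomial_inner_in_nonneg_AG[where \<beta> = \<beta>]) (auto simp: less_imp_le)
    moreover have "posynomial (P - ?F) c \<in> nonneg_AG \<A> \<B>"
      using P c by (intro posynomial_in_nonneg_AG) (auto simp: less_imp_le)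
    ultimately have "c \<alpha> = 0"
      using zero[of "P - ?F" c "posynomial ?F c + b *\<^sub>R m" \<alpha>] eq neq \<alpha> by blast
    then show False using c[OF \<alpha>] by simp
  qed
  \<comment> \<open>The minimum \<open>D\<close> is the largest inner coefficient that the outer terms admit.\<close>
  let ?E = "(\<lambda>\<alpha>. \<alpha> - \<beta>) ` P"
  have inj: "inj_on (\<lambda>\<alpha>. \<alpha> - \<beta>) P" by (auto simp: inj_on_def)
  have "\<exists>w0. \<forall>w. (\<Sum>\<alpha>\<in>?E. c (\<alpha> + \<beta>) * exp (\<alpha> \<bullet> w0)) \<le> (\<Sum>\<alpha>\<in>?E. c (\<alpha> + \<beta>) * exp (\<alpha> \<bullet> w))"
    using P(1) c face by (intro exp_sum_attains_min) auto
  then obtain w0 where w0: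
    "\<And>w. (\<Sum>\<alpha>\<in>P. c \<alpha> * exp ((\<alpha> - \<beta>) \<bullet> w0)) \<le> (\<Sum>\<alpha>\<in>P. c \<alpha> * exp ((\<alpha> - \<beta>) \<bullet> w))"
    unfolding sum.reindex[OF inj] o_def by auto
  define D where "D = (\<Sum>\<alpha>\<in>P. c \<alpha> * exp ((\<alpha> - \<beta>) \<bullet> w0))"
  have sum_D: "(\<Sum>\<alpha>\<in>P. c \<alpha> * exp ((\<alpha> - \<beta>) \<bullet> w)) * exp (\<beta> \<bullet> w) = (\<Sum>\<alpha>\<in>P. c \<alpha> * exp (\<alpha> \<bullet> w))" for w
    unfolding sum_distrib_right by (intro sum.cong) (auto simp: inner_diff_left exp_diff)
  have D_tight: "D * exp (\<beta> \<bullet> w0) = (\<Sum>\<alpha>\<in>P. c \<alpha> * exp (\<alpha> \<bullet> w0))"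
    unfolding D_def sum_D ..
  have D_bound: "D * exp (\<beta> \<bullet> w) \<le> (\<Sum>\<alpha>\<in>P. c \<alpha> * exp (\<alpha> \<bullet> w))" for w
    unfolding sum_D[symmetric] D_def using w0 by (intro mult_right_mono) auto
  have grad: "(\<Sum>\<alpha>\<in>P. (c \<alpha> * exp (\<alpha> \<bullet> w0)) *\<^sub>R \<alpha>) = (D * exp (\<beta> \<bullet> w0)) *\<^sub>R \<beta>"
    using exp_bound_tight_gradient[OF D_bound D_tight] .
  have "b \<le> D" using bound[of w0] unfolding D_tight[symmetric] by simp
  obtain A where A: "A \<subseteq> P" "circuit A \<beta>"
    using convex_hull_rel_interior_simplex[OF P(1) exp_bound_imp_convex_hull[OF P(1) b bound]]
    by (metis circuit_def)
  have finA: "finite A" using A(1) P(1) finite_subset by blast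
  \<comment> \<open>A multiple of a circuit function with outer exponents \<open>A\<close> that is so small that subtracting it from the
    given function leaves a non-negative AG function.\<close>
  define \<epsilon> where "\<epsilon> = Min (insert b ((\<lambda>\<alpha>. c \<alpha> * exp ((\<alpha> - \<beta>) \<bullet> w0)) ` P))"
  have \<epsilon>: "0 < \<epsilon>" "\<epsilon> \<le> b" "\<And>\<alpha>. \<alpha> \<in> P \<Longrightarrow> \<epsilon> \<le> c \<alpha> * exp ((\<alpha> - \<beta>) \<bullet> w0)"
    using P(1) b c unfolding \<epsilon>_def by auto
  define l where "l \<alpha> = (if \<alpha> \<in> A then circuit_coeff A \<beta> \<alpha> else 0)" for \<alpha>
  have l_nonneg: "0 \<le> l \<alpha>" for \<alpha>
    using circuit_coeff_pos[OF A(2)] by (auto simp: l_def less_imp_le)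
  have l_le: "l \<alpha> \<le> 1" for \<alpha>
  proof (cases "\<alpha> \<in> A")
    case True
    then have "l \<alpha> \<le> sum l A" using finA l_nonneg by (intro member_le_sum) auto
    also have "\<dots> = 1" using circuit_coeff_sum[OF A(2)] by (simp add: l_def)
    finally show ?thesis .
  qed (simp add: l_def)
  define d where "d \<alpha> = \<epsilon> * l \<alpha> * exp ((\<beta> - \<alpha>) \<bullet> w0)" for \<alpha>
  have d_tight: "d \<alpha> * exp (\<alpha> \<bullet> w0) = \<epsilon> * l \<alpha> * exp (\<beta> \<bullet> w0)" for \<alpha>
    by (simp add: d_def inner_diff_left exp_diff)
  have d_le: "d \<alpha> \<le> c \<alpha>" if "\<alpha> \<in> P" for \<alpha>
  proof -
    have "d \<alpha> \<le> \<epsilon> * 1 * exp ((\<beta> - \<alpha>) \<bullet> w0)"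
      unfolding d_def using \<epsilon>(1) l_le by (intro mult_right_mono mult_left_mono) auto
    also have "\<dots> \<le> c \<alpha> * exp ((\<alpha> - \<beta>) \<bullet> w0) * exp ((\<beta> - \<alpha>) \<bullet> w0)"
      using \<epsilon>(3)[OF that] by (intro mult_right_mono) auto
    also have "\<dots> = c \<alpha>" by (simp add: inner_diff_left exp_diff)
    finally show ?thesis .
  qed
  have d_sums: "(\<Sum>\<alpha>\<in>P. d \<alpha> * exp (\<alpha> \<bullet> w0)) = \<epsilon> * exp (\<beta> \<bullet> w0)"
    "(\<Sum>\<alpha>\<in>P. (d \<alpha> * exp (\<alpha> \<bullet> w0)) *\<^sub>R \<alpha>) = (\<epsilon> * exp (\<beta> \<bullet> w0)) *\<^sub>R \<beta>"
  proof -
    have "(\<Sum>\<alpha>\<in>P. l \<alpha>) = sum (circuit_coeff A \<beta>) A"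
      using A(1) P(1) by (intro sum.mono_neutral_cong_right) (auto simp: l_def)
    then have 1: "(\<Sum>\<alpha>\<in>P. l \<alpha>) = 1" using circuit_coeff_sum[OF A(2)] by simp
    have "(\<Sum>\<alpha>\<in>P. l \<alpha> *\<^sub>R \<alpha>) = (\<Sum>\<alpha>\<in>A. circuit_coeff A \<beta> \<alpha> *\<^sub>R \<alpha>)"
      using A(1) P(1) by (intro sum.mono_neutral_cong_right) (auto simp: l_def)
    then have 2: "(\<Sum>\<alpha>\<in>P. l \<alpha> *\<^sub>R \<alpha>) = \<beta>" using circuit_coeff_barycenter[OF A(2)] by simp
    have "(\<Sum>\<alpha>\<in>P. d \<alpha> * exp (\<alpha> \<bullet> w0)) = \<epsilon> * exp (\<beta> \<bullet> w0) * (\<Sum>\<alpha>\<in>P. l \<alpha>)"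
      unfolding sum_distrib_left d_tight by (intro sum.cong) (auto simp: mult_ac)
    then show "(\<Sum>\<alpha>\<in>P. d \<alpha> * exp (\<alpha> \<bullet> w0)) = \<epsilon> * exp (\<beta> \<bullet> w0)" using 1 by simp
    have "(\<Sum>\<alpha>\<in>P. (d \<alpha> * exp (\<alpha> \<bullet> w0)) *\<^sub>R \<alpha>) = (\<epsilon> * exp (\<beta> \<bullet> w0)) *\<^sub>R (\<Sum>\<alpha>\<in>P. l \<alpha> *\<^sub>R \<alpha>)"
      unfolding scaleR_sum_right d_tight by (intro sum.cong) (auto simp: mult_ac)
    then show "(\<Sum>\<alpha>\<in>P. (d \<alpha> * exp (\<alpha> \<bullet> w0)) *\<^sub>R \<alpha>) = (\<epsilon> * exp (\<beta> \<bullet> w0)) *\<^sub>R \<beta>" using 2 by simp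
  qed
  have d_nonneg: "0 \<le> d \<alpha>" for \<alpha>
    using \<epsilon>(1) l_nonneg by (simp add: d_def)
  have "posynomial P d + \<epsilon> *\<^sub>R m \<in> nonneg_AG \<A> \<B>"
    using P d_nonneg \<epsilon>(1) m(1,2) d_sums
    by (intro posynomial_inner_in_nonneg_AG[where \<beta> = \<beta>] exp_bound_if_gradient) auto
  moreover have "posynomial P (\<lambda>\<alpha>. c \<alpha> - d \<alpha>) + (b - \<epsilon>) *\<^sub>R m \<in> nonneg_AG \<A> \<B>"
  proof (rule posynomial_inner_in_nonneg_AG[where \<beta> = \<beta>])
    fix w
    have "(b - \<epsilon>) * exp (\<beta> \<bullet> w) \<le> (D - \<epsilon>) * exp (\<beta> \<bullet> w)"
      using \<open>b \<le> D\<close> by (intro mult_right_mono) auto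
    also have "\<dots> \<le> (\<Sum>\<alpha>\<in>P. (c \<alpha> - d \<alpha>) * exp (\<alpha> \<bullet> w))"
    proof (rule exp_bound_if_gradient)
      show "0 \<le> c \<alpha> - d \<alpha>" if "\<alpha> \<in> P" for \<alpha> using d_le[OF that] by simp
      show "(\<Sum>\<alpha>\<in>P. ((c \<alpha> - d \<alpha>) * exp (\<alpha> \<bullet> w0)) *\<^sub>R \<alpha>) = ((D - \<epsilon>) * exp (\<beta> \<bullet> w0)) *\<^sub>R \<beta>"
        using grad d_sums(2) by (simp add: left_diff_distrib scaleR_diff_left sum_subtractf)
      show "(\<Sum>\<alpha>\<in>P. (c \<alpha> - d \<alpha>) * exp (\<alpha> \<bullet> w0)) = (D - \<epsilon>) * exp (\<beta> \<bullet> w0)"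
        using D_tight d_sums(1) by (simp add: left_diff_distrib sum_subtractf)
    qed
    finally show "(b - \<epsilon>) * exp (\<beta> \<bullet> w) \<le> (\<Sum>\<alpha>\<in>P. (c \<alpha> - d \<alpha>) * exp (\<alpha> \<bullet> w))" .
  qed (use P d_le \<epsilon>(2) m(1,2) in auto)
  moreover have "?f = (posynomial P d + \<epsilon> *\<^sub>R m) + (posynomial P (\<lambda>\<alpha>. c \<alpha> - d \<alpha>) + (b - \<epsilon>) *\<^sub>R m)"
  proof -
    have "posynomial P c = posynomial P d + posynomial P (\<lambda>\<alpha>. c \<alpha> - d \<alpha>)"
      by (simp add: posynomial_add)
    then show ?thesis by (simp add: scaleR_diff_left)
  qed
  ultimately obtain t where "posynomial P d + \<epsilon> *\<^sub>R m = t *\<^sub>R ?f"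
    using extreme_ray_summand[OF ext] by blast
  then have eq: "posynomial P d + \<epsilon> *\<^sub>R m = posynomial P (\<lambda>\<alpha>. t * c \<alpha>) + (t * b) *\<^sub>R m"
    by (simp add: scaleR_add_right posynomial_scaleR)
  have "m = - abs_mono \<beta> \<Longrightarrow> \<beta> \<notin> P \<union> P" using m(3) by blast
  note unique = normal_form_unique[OF eq m(1) P(1) P(1) this]
  have t: "t * b = \<epsilon>" using unique(1) by simp
  then have "t \<noteq> 0" using \<epsilon>(1) by auto
  have d_eq: "d \<alpha> = t * c \<alpha>" if "\<alpha> \<in> P" for \<alpha> using unique(2)[of \<alpha>] that by simp
  have "\<alpha> \<in> A" if "\<alpha> \<in> P" for \<alpha>
  proof (rule ccontr)
    assume "\<alpha> \<notin> A"
    then have "t * c \<alpha> = 0" using d_eq[OF that] by (simp add: d_def l_def)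
    then show False using \<open>t \<noteq> 0\<close> c[OF that] by simp
  qed
  then have "A = P" using A(1) by blast
  show ?thesis
  proof (rule that[of w0])
    show "circuit P \<beta>" using A(2) \<open>A = P\<close> by simp
    fix \<alpha> assume \<alpha>: "\<alpha> \<in> P"
    have "t * (c \<alpha> * exp (\<alpha> \<bullet> w0)) = t * (b * circuit_coeff P \<beta> \<alpha> * exp (\<beta> \<bullet> w0))"
      using d_tight[of \<alpha>] \<alpha> \<open>A = P\<close> by (simp add: d_eq[OF \<alpha>] l_def t[symmetric] mult.assoc)
    then show "c \<alpha> * exp (\<alpha> \<bullet> w0) = b * circuit_coeff P \<beta> \<alpha> * exp (\<beta> \<bullet> w0)"
      using \<open>t \<noteq> 0\<close> by simp
  qed
qed

text \<open>A further exponent \<open>\<gamma> \<in> \<A>\<close> in the simplex allows to split off a small multiple of the even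
  AG function with inner exponent \<open>\<gamma>\<close> that vanishes at \<open>w0\<close>. In the remainder \<open>|x|^\<gamma>\<close> has a positive
  coefficient.\<close>

lemma extreme_ray_circuit_reduced:
  assumes ext: "generates_extreme_ray (S_cone \<A> \<B>) (posynomial A c + b *\<^sub>R m)"
    and A: "A \<subseteq> \<A>" and b: "0 < b"
    and m: "inner_term m \<beta>" "m \<in> sig_space \<A> \<B>"
    and circ: "circuit A \<beta>"
    and tight: "\<And>\<alpha>. \<alpha> \<in> A \<Longrightarrow> c \<alpha> * exp (\<alpha> \<bullet> w0) = b * circuit_coeff A \<beta> \<alpha> * exp (\<beta> \<bullet> w0)"
    and \<gamma>: "\<gamma> \<in> convex hull A" "\<gamma> \<in> \<A>" "\<gamma> \<notin> A"
  shows "m = - abs_mono \<beta> \<and> \<gamma> = \<beta>"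
proof (rule ccontr)
  assume neq: "\<not> (m = - abs_mono \<beta> \<and> \<gamma> = \<beta>)"
  let ?l = "circuit_coeff A \<beta>"
  let ?f = "posynomial A c + b *\<^sub>R m"
  have fin: "finite A" using circ by (simp add: circuit_def aff_independent_finite)
  obtain \<mu> where \<mu>: "\<forall>\<alpha>\<in>A. 0 \<le> \<mu> \<alpha>" "sum \<mu> A = 1" "(\<Sum>\<alpha>\<in>A. \<mu> \<alpha> *\<^sub>R \<alpha>) = \<gamma>"
    using \<gamma>(1) unfolding convex_hull_finite[OF fin] by auto
  have "A \<noteq> {}" using \<mu>(2) by auto
  have \<mu>_le: "\<mu> \<alpha> \<le> 1" if "\<alpha> \<in> A" for \<alpha>
    using member_le_sum[of \<alpha> A \<mu>] that \<mu> fin by auto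
  define \<epsilon> where "\<epsilon> = b * exp (\<beta> \<bullet> w0) * Min (?l ` A)"
  have "0 < Min (?l ` A)" using fin \<open>A \<noteq> {}\<close> circuit_coeff_pos[OF circ] by auto
  then have \<epsilon>: "0 < \<epsilon>" using b by (simp add: \<epsilon>_def)
  define d where "d \<alpha> = \<epsilon> * \<mu> \<alpha> * exp (- (\<alpha> \<bullet> w0))" for \<alpha>
  define e where "e \<alpha> = (if \<alpha> = \<gamma> then \<epsilon> * exp (- (\<gamma> \<bullet> w0)) else c \<alpha> - d \<alpha>)" for \<alpha>
  have d_tight: "d \<alpha> * exp (\<alpha> \<bullet> w0) = \<epsilon> * \<mu> \<alpha>" for \<alpha>
    by (simp add: d_def exp_minus)
  have d_le: "d \<alpha> \<le> c \<alpha>" if "\<alpha> \<in> A" for \<alpha>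
  proof -
    have "Min (?l ` A) \<le> ?l \<alpha>" using that fin by simp
    then have "\<epsilon> \<le> b * exp (\<beta> \<bullet> w0) * ?l \<alpha>"
      unfolding \<epsilon>_def using b by (intro mult_left_mono) auto
    then have "\<epsilon> * \<mu> \<alpha> \<le> b * exp (\<beta> \<bullet> w0) * ?l \<alpha>"
      using \<epsilon> \<mu>_le[OF that] by (meson less_imp_le mult_left_le order_trans)
    then have "d \<alpha> * exp (\<alpha> \<bullet> w0) \<le> c \<alpha> * exp (\<alpha> \<bullet> w0)"
      unfolding d_tight tight[OF that] by (simp add: mult_ac)
    then show ?thesis by simp
  qed
  have e_A: "e \<alpha> = c \<alpha> - d \<alpha>" if "\<alpha> \<in> A" for \<alpha>
    using that \<gamma>(3) by (auto simp: e_def)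
  have sum_A: "(\<Sum>\<alpha>\<in>A. e \<alpha> * exp (\<alpha> \<bullet> w0)) = b * exp (\<beta> \<bullet> w0) - \<epsilon>"
    "(\<Sum>\<alpha>\<in>A. (e \<alpha> * exp (\<alpha> \<bullet> w0)) *\<^sub>R \<alpha>) = (b * exp (\<beta> \<bullet> w0)) *\<^sub>R \<beta> - \<epsilon> *\<^sub>R \<gamma>"
  proof -
    have e_tight: "e \<alpha> * exp (\<alpha> \<bullet> w0) = (b * exp (\<beta> \<bullet> w0)) * ?l \<alpha> - \<epsilon> * \<mu> \<alpha>" if "\<alpha> \<in> A" for \<alpha>
      unfolding e_A[OF that] left_diff_distrib d_tight tight[OF that] by simp
    have "(\<Sum>\<alpha>\<in>A. e \<alpha> * exp (\<alpha> \<bullet> w0)) = (b * exp (\<beta> \<bullet> w0)) * sum ?l A - \<epsilon> * sum \<mu> A"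
      by (simp add: e_tight sum_subtractf sum_distrib_left)
    then show "(\<Sum>\<alpha>\<in>A. e \<alpha> * exp (\<alpha> \<bullet> w0)) = b * exp (\<beta> \<bullet> w0) - \<epsilon>"
      by (simp add: circuit_coeff_sum[OF circ] \<mu>(2))
    have "(\<Sum>\<alpha>\<in>A. (e \<alpha> * exp (\<alpha> \<bullet> w0)) *\<^sub>R \<alpha>) =
        (b * exp (\<beta> \<bullet> w0)) *\<^sub>R (\<Sum>\<alpha>\<in>A. ?l \<alpha> *\<^sub>R \<alpha>) - \<epsilon> *\<^sub>R (\<Sum>\<alpha>\<in>A. \<mu> \<alpha> *\<^sub>R \<alpha>)"
      by (simp add: e_tight sum_subtractf scaleR_sum_right scaleR_diff_left)
    then show "(\<Sum>\<alpha>\<in>A. (e \<alpha> * exp (\<alpha> \<bullet> w0)) *\<^sub>R \<alpha>) = (b * exp (\<beta> \<bullet> w0)) *\<^sub>R \<beta> - \<epsilon> *\<^sub>R \<gamma>"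
      by (simp add: circuit_coeff_barycenter[OF circ] \<mu>(3))
  qed
  have e_\<gamma>: "e \<gamma> * exp (\<gamma> \<bullet> w0) = \<epsilon>" by (simp add: e_def exp_minus)
  let ?g = "posynomial A d + (\<epsilon> * exp (- (\<gamma> \<bullet> w0))) *\<^sub>R (- abs_mono \<gamma>)"
  have "?g \<in> nonneg_AG \<A> \<B>"
  proof (rule posynomial_inner_in_nonneg_AG[where \<beta> = \<gamma>, OF fin A])
    show "0 \<le> d \<alpha>" if "\<alpha> \<in> A" for \<alpha> using \<mu>(1) \<epsilon> that by (simp add: d_def)
    then show "\<epsilon> * exp (- (\<gamma> \<bullet> w0)) * exp (\<gamma> \<bullet> w) \<le> (\<Sum>\<alpha>\<in>A. d \<alpha> * exp (\<alpha> \<bullet> w))" for w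
    proof (rule exp_bound_if_gradient[of A _ w0])
      show "(\<Sum>\<alpha>\<in>A. (d \<alpha> * exp (\<alpha> \<bullet> w0)) *\<^sub>R \<alpha>) = (\<epsilon> * exp (- (\<gamma> \<bullet> w0)) * exp (\<gamma> \<bullet> w0)) *\<^sub>R \<gamma>"
      proof -
        have "(\<Sum>\<alpha>\<in>A. (d \<alpha> * exp (\<alpha> \<bullet> w0)) *\<^sub>R \<alpha>) = \<epsilon> *\<^sub>R (\<Sum>\<alpha>\<in>A. \<mu> \<alpha> *\<^sub>R \<alpha>)"
          unfolding d_tight scaleR_sum_right by simp
        then show ?thesis by (simp add: \<mu>(3) exp_minus)
      qed
      show "(\<Sum>\<alpha>\<in>A. d \<alpha> * exp (\<alpha> \<bullet> w0)) = \<epsilon> * exp (- (\<gamma> \<bullet> w0)) * exp (\<gamma> \<bullet> w0)"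
        unfolding d_tight using \<mu>(2) by (simp add: exp_minus sum_distrib_left[symmetric])
    qed
    show "- abs_mono \<gamma> \<in> sig_space \<A> \<B>" using \<gamma>(2) by (auto simp: sig_space_iff_lookup)
  qed (use \<epsilon> in \<open>auto simp: inner_term_def\<close>)
  moreover have "posynomial (insert \<gamma> A) e + b *\<^sub>R m \<in> nonneg_AG \<A> \<B>"
  proof (rule posynomial_inner_in_nonneg_AG[where \<beta> = \<beta>])
    show nonneg: "0 \<le> e \<alpha>" if "\<alpha> \<in> insert \<gamma> A" for \<alpha>
      using that d_le \<epsilon> by (auto simp: e_def)
    show "b * exp (\<beta> \<bullet> w) \<le> (\<Sum>\<alpha>\<in>insert \<gamma> A. e \<alpha> * exp (\<alpha> \<bullet> w))" for w
      using nonneg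
    proof (rule exp_bound_if_gradient[of _ _ w0])
      show "(\<Sum>\<alpha>\<in>insert \<gamma> A. (e \<alpha> * exp (\<alpha> \<bullet> w0)) *\<^sub>R \<alpha>) = (b * exp (\<beta> \<bullet> w0)) *\<^sub>R \<beta>"
        using fin \<gamma>(3) by (simp add: sum_A e_\<gamma>)
      show "(\<Sum>\<alpha>\<in>insert \<gamma> A. e \<alpha> * exp (\<alpha> \<bullet> w0)) = b * exp (\<beta> \<bullet> w0)"
        using fin \<gamma>(3) by (simp add: sum_A e_\<gamma>)
    qed
  qed (use fin A \<gamma>(2) b m in auto)
  moreover have "?f = ?g + (posynomial (insert \<gamma> A) e + b *\<^sub>R m)"
  proof -
    have "posynomial (insert \<gamma> A) e = (\<epsilon> * exp (- (\<gamma> \<bullet> w0))) *\<^sub>R abs_mono \<gamma> + posynomial A e"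
      unfolding posynomial_def using fin \<gamma>(3) by (simp add: e_def)
    moreover have "posynomial A e = posynomial A (\<lambda>\<alpha>. c \<alpha> - d \<alpha>)"
      unfolding posynomial_def by (intro sum.cong) (auto simp: e_A)
    moreover have "posynomial A c = posynomial A d + posynomial A (\<lambda>\<alpha>. c \<alpha> - d \<alpha>)"
      by (simp add: posynomial_add)
    ultimately show ?thesis by simp
  qed
  ultimately obtain t where "?g = t *\<^sub>R ?f"
    using extreme_ray_summand[OF ext] by blast
  then have "Poly_Mapping.lookup (fst ?g) \<gamma> = Poly_Mapping.lookup (fst (t *\<^sub>R ?f)) \<gamma>" by simp
  moreover have "Poly_Mapping.lookup (fst m) \<gamma> = 0"
    using m(1) neq unfolding inner_term_def by auto
  ultimately show False
    using \<epsilon> \<gamma>(3) fin by (simp add: lookup_fst_posynomial lookup_add lookup_minus)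
qed

text \<open>The extreme rays without inner term are single monomials. If \<open>x^\<beta>\<close> is available, \<open>|x|^\<beta>\<close> is the
  midpoint of \<open>|x|^\<beta> + x^\<beta>\<close> and \<open>|x|^\<beta> - x^\<beta>\<close>.\<close>

lemma extreme_ray_posynomial:
  assumes ext: "generates_extreme_ray (S_cone \<A> \<B>) (posynomial P c)"
    and P: "finite P" "P \<subseteq> \<A>" and c: "\<And>\<alpha>. \<alpha> \<in> P \<Longrightarrow> 0 < c \<alpha>"
    and \<B>: "\<forall>\<beta>\<in>\<B>. \<not> (\<forall>j. even (\<beta> $ j))"
  shows "posynomial P c \<in> (\<Union>\<beta>\<in>\<A>. E_one \<B> \<beta>)"
proof -
  have "posynomial P c \<noteq> 0" using ext by (simp add: generates_extreme_ray_def)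
  then have "P \<noteq> {}" by (auto simp: posynomial_def)
  then obtain \<alpha> where \<alpha>: "\<alpha> \<in> P" by blast
  have mono: "posynomial {\<alpha>} c = c \<alpha> *\<^sub>R abs_mono \<alpha>" by (simp add: posynomial_def)
  have "posynomial P c = posynomial {\<alpha>} c + posynomial (P - {\<alpha>}) c"
    unfolding posynomial_def using P(1) \<alpha> by (simp add: sum.remove)
  moreover have "posynomial Q c \<in> nonneg_AG \<A> \<B>" if "Q \<subseteq> P" for Q
    using that P c by (intro posynomial_in_nonneg_AG) (auto intro: finite_subset less_imp_le)
  ultimately have "\<exists>t\<ge>0. posynomial {\<alpha>} c = t *\<^sub>R posynomial P c"
    using \<alpha> by (intro extreme_ray_summand[OF ext]) blast+
  then obtain t where t: "t \<ge> 0" "c \<alpha> *\<^sub>R abs_mono \<alpha> = t *\<^sub>R posynomial P c"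
    unfolding mono by blast
  have "t \<noteq> 0"
  proof
    assume "t = 0"
    then show False
      using arg_cong[OF t(2), of "\<lambda>f. Poly_Mapping.lookup (fst f) \<alpha>"] c[OF \<alpha>] by simp
  qed
  define r where "r = c \<alpha> / t"
  have r: "0 < r" using t(1) \<open>t \<noteq> 0\<close> c[OF \<alpha>] by (simp add: r_def)
  have "posynomial P c = inverse t *\<^sub>R (t *\<^sub>R posynomial P c)" using \<open>t \<noteq> 0\<close> by simp
  then have f: "posynomial P c = r *\<^sub>R abs_mono \<alpha>"
    unfolding t(2)[symmetric] by (simp add: r_def divide_inverse mult.commute)
  have "\<alpha> \<notin> real_vec ` \<B>"
  proof
    assume "\<alpha> \<in> real_vec ` \<B>"
    then obtain \<beta>' where \<beta>': "\<beta>' \<in> \<B>" "real_vec \<beta>' = \<alpha>" by blast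
    then have odd: "\<exists>j. odd (\<beta>' $ j)" using \<B> by blast
    have "posynomial {\<alpha>} (\<lambda>_. r/2) + (r/2) *\<^sub>R m \<in> nonneg_AG \<A> \<B>"
      if "m = nat_mono \<beta>' \<or> m = - nat_mono \<beta>'" for m
      using P(2) \<alpha> r that \<beta>' odd
      by (intro posynomial_inner_in_nonneg_AG[where \<beta> = \<alpha>])
        (auto simp: inner_term_def sig_space_iff_lookup)
    then have "posynomial {\<alpha>} (\<lambda>_. r/2) + (r/2) *\<^sub>R nat_mono \<beta>' \<in> nonneg_AG \<A> \<B>"
      "posynomial {\<alpha>} (\<lambda>_. r/2) + (r/2) *\<^sub>R - nat_mono \<beta>' \<in> nonneg_AG \<A> \<B>" by blast+
    moreover have "posynomial P c = (posynomial {\<alpha>} (\<lambda>_. r/2) + (r/2) *\<^sub>R nat_mono \<beta>') +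
        (posynomial {\<alpha>} (\<lambda>_. r/2) + (r/2) *\<^sub>R - nat_mono \<beta>')"
      unfolding f by (simp add: posynomial_def scaleR_add_left[symmetric])
    ultimately obtain u where
      "posynomial {\<alpha>} (\<lambda>_. r/2) + (r/2) *\<^sub>R nat_mono \<beta>' = u *\<^sub>R posynomial P c"
      using extreme_ray_summand[OF ext] by blast
    then have "Poly_Mapping.lookup (snd (posynomial {\<alpha>} (\<lambda>_. r/2) + (r/2) *\<^sub>R nat_mono \<beta>')) \<beta>' =
        Poly_Mapping.lookup (snd (u *\<^sub>R posynomial P c)) \<beta>'" by simp
    then show False using r by simp
  qed
  then have "posynomial P c \<in> E_one \<B> \<alpha>"
    unfolding f E_one_def using r by (auto intro!: exI[of _ r])
  then show ?thesis using P(2) \<alpha> by blast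
qed


section \<open>Reduced circuit functions generate extreme rays\<close>

lemma torus_eval_sum_list: "torus_eval s w (sum_list gs) = (\<Sum>g\<leftarrow>gs. torus_eval s w g)"
  using torus_eval_scaleR[of s w 0 0] by (induction gs) (simp_all add: torus_eval_add)

lemma lookup_sum_list:
  fixes gs :: "'n::finite signomial list"
  shows "Poly_Mapping.lookup (fst (sum_list gs)) \<alpha> = (\<Sum>g\<leftarrow>gs. Poly_Mapping.lookup (fst g) \<alpha>)"
    and "Poly_Mapping.lookup (snd (sum_list gs)) \<beta> = (\<Sum>g\<leftarrow>gs. Poly_Mapping.lookup (snd g) \<beta>)"
  by (induction gs) (simp_all add: lookup_add)

lemma sum_list_nonneg_eq_0D:
  fixes h :: "'a \<Rightarrow> real"
  assumes "\<And>g. g \<in> set gs \<Longrightarrow> 0 \<le> h g" and "(\<Sum>g\<leftarrow>gs. h g) = 0" and "g \<in> set gs"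
  shows "h g = 0"
  using sum_list_nonneg_eq_0_iff[of "map h gs"] assms by auto

text \<open>By \<open>exp_bound_imp_convex_hull\<close>, applied to the inner exponent.\<close>

lemma nonneg_AG_keys_in_hull:
  assumes \<B>: "\<forall>\<beta>\<in>\<B>. \<not> (\<forall>j. even (\<beta> $ j))" and g: "g \<in> nonneg_AG \<A> \<B>"
  shows "Poly_Mapping.keys (fst g) \<union> real_vec ` Poly_Mapping.keys (snd g) \<subseteq> convex hull pos_keys g"
proof -
  let ?c = "Poly_Mapping.lookup (fst g)"
  consider "g = posynomial (pos_keys g) ?c"
    | b m \<beta> where "g = posynomial (pos_keys g) ?c + b *\<^sub>R m" "0 < b" "inner_term m \<beta>"
    using AG_normal_form[OF \<B> g] by metis
  then show ?thesis
  proof cases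
    case 1
    then have "?c \<alpha> = (if 0 < ?c \<alpha> then ?c \<alpha> else 0)" for \<alpha>
      by (metis lookup_fst_posynomial_pos_keys)
    then have "Poly_Mapping.keys (fst g) \<subseteq> pos_keys g"
      unfolding pos_keys_def by (metis (mono_tags, lifting) in_keys_iff mem_Collect_eq subsetI)
    moreover have "snd g = 0" using 1 by (metis snd_posynomial)
    ultimately show ?thesis by (auto intro: hull_inc)
  next
    case 2
    have "b * exp (\<beta> \<bullet> w) \<le> (\<Sum>\<alpha>\<in>pos_keys g. ?c \<alpha> * exp (\<alpha> \<bullet> w))" for w
      using g sig_nonneg_iff_exp_bound[OF 2(3), of b "pos_keys g" ?c] 2(1,2)
      by (simp add: nonneg_AG_def)
    then have \<beta>: "\<beta> \<in> convex hull pos_keys g"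
      using exp_bound_imp_convex_hull[OF finite_pos_keys 2(2)] by blast
    have m: "Poly_Mapping.lookup (fst m) \<alpha> \<noteq> 0 \<Longrightarrow> \<alpha> = \<beta>"
      "Poly_Mapping.lookup (snd m) \<beta>' \<noteq> 0 \<Longrightarrow> real_vec \<beta>' = \<beta>" for \<alpha> \<beta>'
      using 2(3) unfolding inner_term_def by (auto split: if_splits)
    have "\<alpha> \<in> convex hull pos_keys g" if "\<alpha> \<in> Poly_Mapping.keys (fst g)" for \<alpha>
    proof (cases "\<alpha> \<in> pos_keys g")
      case False
      have "?c \<alpha> = Poly_Mapping.lookup (fst (posynomial (pos_keys g) ?c + b *\<^sub>R m)) \<alpha>"
        using 2(1) by simp
      also have "\<dots> = b * Poly_Mapping.lookup (fst m) \<alpha>"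
        using False by (simp add: lookup_add lookup_fst_posynomial[OF finite_pos_keys])
      finally have "\<alpha> = \<beta>" using that m(1)[of \<alpha>] by (auto simp: in_keys_iff)
      then show ?thesis using \<beta> by simp
    qed (rule hull_inc)
    moreover have "real_vec \<beta>' \<in> convex hull pos_keys g" if "\<beta>' \<in> Poly_Mapping.keys (snd g)" for \<beta>'
    proof -
      have "Poly_Mapping.lookup (snd g) \<beta>' = Poly_Mapping.lookup (snd (posynomial (pos_keys g) ?c + b *\<^sub>R m)) \<beta>'"
        using 2(1) by simp
      also have "\<dots> = b * Poly_Mapping.lookup (snd m) \<beta>'" by simp
      finally have "real_vec \<beta>' = \<beta>" using that m(2)[of \<beta>'] by (auto simp: in_keys_iff)
      then show ?thesis using \<beta> by simp
    qed
    ultimately show ?thesis by blast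
  qed
qed

text \<open>No exponent of a summand leaves the Newton polytope of the sum: at a vertex of the polytope spanned by all
  exponents no summand has a negative coefficient, since a negative exponent lies in the hull of positive ones.
  Hence nothing cancels there, and the vertex is an exponent of the sum.\<close>

lemma summand_keys_in_hull:
  assumes \<B>: "\<forall>\<beta>\<in>\<B>. \<not> (\<forall>j. even (\<beta> $ j))"
    and gs: "set gs \<subseteq> nonneg_AG \<A> \<B>" and g: "g \<in> set gs"
  shows "Poly_Mapping.keys (fst g) \<union> real_vec ` Poly_Mapping.keys (snd g)
    \<subseteq> convex hull pos_keys (sum_list gs)"
proof -
  define P where "P = (\<Union>g\<in>set gs. pos_keys g)"
  have "finite P" by (simp add: P_def finite_pos_keys)
  have "v \<in> pos_keys (sum_list gs)" if v: "v extreme_point_of (convex hull P)" for v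
  proof -
    have nonneg: "0 \<le> Poly_Mapping.lookup (fst h) v" if h: "h \<in> set gs" for h
    proof (rule ccontr)
      assume neg: "\<not> 0 \<le> Poly_Mapping.lookup (fst h) v"
      then have "v \<in> Poly_Mapping.keys (fst h)" by (simp add: in_keys_iff)
      then have "v \<in> convex hull pos_keys h"
        using nonneg_AG_keys_in_hull[OF \<B>] gs h by blast
      moreover have "pos_keys h \<subseteq> (convex hull P) - {v}"
        using neg h hull_subset[of P convex] by (auto simp: P_def pos_keys_def)
      then have "convex hull pos_keys h \<subseteq> (convex hull P) - {v}"
        using v by (intro hull_minimal) (simp_all add: extreme_point_of_stillconvex)
      ultimately show False by blast
    qed
    have "v \<in> P" using extreme_point_of_convex_hull[OF v] .
    then obtain h where h: "h \<in> set gs" "0 < Poly_Mapping.lookup (fst h) v"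
      by (auto simp: P_def pos_keys_def)
    have "0 \<le> (\<Sum>g\<leftarrow>gs. Poly_Mapping.lookup (fst g) v)"
      using nonneg by (intro sum_list_nonneg) auto
    moreover have "(\<Sum>g\<leftarrow>gs. Poly_Mapping.lookup (fst g) v) \<noteq> 0"
      using sum_list_nonneg_eq_0D[of gs "\<lambda>g. Poly_Mapping.lookup (fst g) v" h] nonneg h by force
    ultimately show ?thesis
      by (simp add: pos_keys_def lookup_sum_list)
  qed
  then have "convex hull {v. v extreme_point_of (convex hull P)} \<subseteq> convex hull pos_keys (sum_list gs)"
    by (intro hull_mono) blast
  then have "convex hull P \<subseteq> convex hull pos_keys (sum_list gs)"
    using Krein_Milman_Minkowski[of "convex hull P"] \<open>finite P\<close>
    by (simp add: finite_imp_compact_convex_hull)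
  moreover have "convex hull pos_keys g \<subseteq> convex hull P"
    using g by (intro hull_mono) (auto simp: P_def)
  moreover have "Poly_Mapping.keys (fst g) \<union> real_vec ` Poly_Mapping.keys (snd g) \<subseteq> convex hull pos_keys g"
    using nonneg_AG_keys_in_hull[OF \<B>] gs g by blast
  ultimately show ?thesis by blast
qed

text \<open>At a zero of an AG function its odd term has the sign that makes it non-positive.\<close>

lemma AG_zero_odd_term_nonpos:
  assumes g: "AG g" and zero: "torus_eval s w g = 0"
  shows "Poly_Mapping.lookup (snd g) \<beta> * nat_power s \<beta> \<le> 0"
proof (cases "\<beta> \<in> Poly_Mapping.keys (snd g)")
  case True
  then have "snd g \<noteq> 0" by auto
  then have g': "\<forall>\<alpha>. 0 \<le> Poly_Mapping.lookup (fst g) \<alpha>" "card (Poly_Mapping.keys (snd g)) \<le> 1"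
    using g by (auto simp: AG_def even_AG_def odd_AG_def)
  have "card {\<beta>} = card (Poly_Mapping.keys (snd g))"
    using True g'(2) card_mono[of "Poly_Mapping.keys (snd g)" "{\<beta>}"] by simp
  then have "{\<beta>} = Poly_Mapping.keys (snd g)"
    using True by (intro card_subset_eq) auto
  then have "torus_eval s w g = (\<Sum>\<alpha>\<in>Poly_Mapping.keys (fst g). Poly_Mapping.lookup (fst g) \<alpha> * exp (\<alpha> \<bullet> w))
      + (Poly_Mapping.lookup (snd g) \<beta> * nat_power s \<beta>) * exp (real_vec \<beta> \<bullet> w)"
    unfolding torus_eval_def by (metis (no_types, lifting) finite.emptyI empty_iff sum.empty sum.insert add.right_neutral mult.assoc)
  moreover have "0 \<le> (\<Sum>\<alpha>\<in>Poly_Mapping.keys (fst g). Poly_Mapping.lookup (fst g) \<alpha> * exp (\<alpha> \<bullet> w))"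
    using g'(1) by (intro sum_nonneg) auto
  ultimately have "(Poly_Mapping.lookup (snd g) \<beta> * nat_power s \<beta>) * exp (real_vec \<beta> \<bullet> w) \<le> 0"
    using zero by linarith
  then show ?thesis by (simp add: mult_le_0_iff)
qed (simp add: in_keys_iff)

text \<open>In a decomposition every summand vanishes where the circuit function does. This rules out all odd terms
  but the inner one, because the odd terms of the summands cannot cancel there. As the simplex contains no
  further exponents, a summand has no other exponents than the circuit function; and because its
  gradient vanishes too, its coefficients are determined up to a factor.\<close>

lemma reduced_circuit_function_extreme:
  assumes \<B>: "\<forall>\<beta>\<in>\<B>. \<not> (\<forall>j. even (\<beta> $ j))"
    and circ: "circuit A \<beta>" and A: "A \<subseteq> \<A>" and c: "\<And>\<alpha>. \<alpha> \<in> A \<Longrightarrow> 0 < c \<alpha>"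
    and m: "inner_term m \<beta>" "m \<in> sig_space \<A> \<B>" "m = - abs_mono \<beta> \<Longrightarrow> \<beta> \<notin> A"
    and reduced: "\<And>\<gamma>. \<gamma> \<in> convex hull A \<Longrightarrow> \<gamma> \<in> \<A> \<Longrightarrow> \<gamma> \<in> A \<or> (m = - abs_mono \<beta> \<and> \<gamma> = \<beta>)"
  shows "generates_extreme_ray (S_cone \<A> \<B>) (posynomial A c + circuit_number A \<beta> c *\<^sub>R m)"
proof -
  define b where "b = circuit_number A \<beta> c"
  let ?f = "posynomial A c + b *\<^sub>R m"
  have fin: "finite A" using circ by (simp add: circuit_def aff_independent_finite)
  have "A \<noteq> {}" using circ by (auto simp: circuit_def)
  obtain w0 where b: "0 < b" and
    tight: "\<And>\<alpha>. \<alpha> \<in> A \<Longrightarrow> c \<alpha> * exp (\<alpha> \<bullet> w0) = b * circuit_coeff A \<beta> \<alpha> * exp (\<beta> \<bullet> w0)"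
    using circuit_number_tight_point[of A \<beta> c] circ c unfolding b_def by metis
  obtain s where s: "s \<in> sign_vecs" "\<And>w. torus_eval s w m = - exp (\<beta> \<bullet> w)"
    using inner_term_lower_bound_attained[OF m(1)] by blast
  have f_zero: "torus_eval s w0 ?f = 0"
  proof -
    have "(\<Sum>\<alpha>\<in>A. c \<alpha> * exp (\<alpha> \<bullet> w0)) = b * exp (\<beta> \<bullet> w0) * sum (circuit_coeff A \<beta>) A"
      unfolding sum_distrib_left by (intro sum.cong) (auto simp: tight mult_ac)
    then show ?thesis
      by (simp add: torus_eval_add torus_eval_posynomial torus_eval_scaleR s(2) circuit_coeff_sum[OF circ])
  qed
  have "?f \<in> nonneg_AG \<A> \<B>"
    using fin A c b m(1,2) circuit_bound[OF circ _ tight]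
    by (intro posynomial_inner_in_nonneg_AG[where \<beta> = \<beta>]) (auto simp: less_imp_le)
  moreover have "?f \<noteq> 0"
  proof
    assume "?f = 0"
    then have "posynomial A c + b *\<^sub>R m = posynomial {} c + 0 *\<^sub>R m" by (simp add: posynomial_def)
    then have "b = 0"
      using normal_form_unique(1)[of A c b m "{}" c 0 \<beta>] m(1,3) fin by simp
    then show False using b by simp
  qed
  moreover have "\<exists>t\<ge>0. g = t *\<^sub>R ?f"
    if gs: "set gs \<subseteq> nonneg_AG \<A> \<B>" and f: "?f = sum_list gs" and g: "g \<in> set gs" for gs g
  proof -
    have zero: "torus_eval s w0 h = 0" if "h \<in> set gs" for h
    proof (rule sum_list_nonneg_eq_0D[OF _ _ that])
      show "0 \<le> torus_eval s w0 h" if "h \<in> set gs" for h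
        using gs that s(1) by (auto simp: nonneg_AG_def sig_nonneg_iff_torus)
      show "(\<Sum>h\<leftarrow>gs. torus_eval s w0 h) = 0"
        using f_zero unfolding f torus_eval_sum_list .
    qed
    have odd_terms: "Poly_Mapping.lookup (snd g) \<gamma> = 0" if "Poly_Mapping.lookup (snd m) \<gamma> = 0" for \<gamma>
    proof -
      have "(\<Sum>h\<leftarrow>gs. Poly_Mapping.lookup (snd h) \<gamma>) = Poly_Mapping.lookup (snd ?f) \<gamma>"
        unfolding f lookup_sum_list ..
      then have "(\<Sum>h\<leftarrow>gs. Poly_Mapping.lookup (snd h) \<gamma>) = 0" using that by simp
      then have "(\<Sum>h\<leftarrow>gs. - (Poly_Mapping.lookup (snd h) \<gamma> * nat_power s \<gamma>)) = 0"
        by (simp add: sum_list_mult_const uminus_sum_list_map[unfolded o_def, symmetric])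
      moreover have "0 \<le> - (Poly_Mapping.lookup (snd h) \<gamma> * nat_power s \<gamma>)" if "h \<in> set gs" for h
        using AG_zero_odd_term_nonpos[OF _ zero[OF that], of \<gamma>] gs that by (auto simp: nonneg_AG_def)
      ultimately have "- (Poly_Mapping.lookup (snd g) \<gamma> * nat_power s \<gamma>) = 0"
        using sum_list_nonneg_eq_0D[of gs "\<lambda>h. - (Poly_Mapping.lookup (snd h) \<gamma> * nat_power s \<gamma>)" g] g by blast
      then show ?thesis
        using nat_power_sign_vec[OF s(1), of \<gamma>] by auto
    qed
    have m_nonpos: "Poly_Mapping.lookup (fst m) \<alpha> \<le> 0" for \<alpha>
      using m(1) unfolding inner_term_def by auto
    have "pos_keys ?f \<subseteq> A"
    proof
      fix \<alpha> assume "\<alpha> \<in> pos_keys ?f"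
      then have "0 < (if \<alpha> \<in> A then c \<alpha> else 0) + b * Poly_Mapping.lookup (fst m) \<alpha>"
        by (simp add: pos_keys_def lookup_add lookup_fst_posynomial[OF fin])
      moreover have "b * Poly_Mapping.lookup (fst m) \<alpha> \<le> 0"
        using b m_nonpos[of \<alpha>] by (simp add: mult_le_0_iff)
      ultimately show "\<alpha> \<in> A" by (cases "\<alpha> \<in> A") auto
    qed
    then have "Poly_Mapping.keys (fst g) \<subseteq> convex hull A"
      using summand_keys_in_hull[OF \<B> gs g] hull_mono[of "pos_keys ?f" A convex] unfolding f by blast
    moreover have "Poly_Mapping.keys (fst g) \<subseteq> \<A>"
      using gs g by (auto simp: nonneg_AG_def sig_space_def)
    ultimately have keys: "Poly_Mapping.lookup (fst g) \<alpha> = 0"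
      if "\<alpha> \<notin> A" "\<not> (m = - abs_mono \<beta> \<and> \<alpha> = \<beta>)" for \<alpha>
      using that reduced[of \<alpha>] by (meson in_keys_iff subsetD)
    let ?d = "Poly_Mapping.lookup (fst g)"
    obtain u where u: "g = posynomial A ?d + u *\<^sub>R m"
    proof -
      consider "m = - abs_mono \<beta>"
        | \<beta>' r where "m = r *\<^sub>R nat_mono \<beta>'" "r = 1 \<or> r = (-1::real)"
        using m(1) unfolding inner_term_def by (metis scaleR_minus1_left scaleR_one)
      then show thesis
      proof cases
        case 1
        have "g = posynomial A ?d + (- ?d \<beta>) *\<^sub>R m"
        proof (rule signomial_eqI)
          show "?d \<alpha> = Poly_Mapping.lookup (fst (posynomial A ?d + (- ?d \<beta>) *\<^sub>R m)) \<alpha>" for \<alpha>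
            using keys[of \<alpha>] m(3)[OF 1] fin by (auto simp: lookup_add lookup_fst_posynomial 1)
          show "Poly_Mapping.lookup (snd g) \<gamma> =
              Poly_Mapping.lookup (snd (posynomial A ?d + (- ?d \<beta>) *\<^sub>R m)) \<gamma>" for \<gamma>
            using odd_terms[of \<gamma>] by (simp add: 1)
        qed
        then show thesis by (rule that)
      next
        case 2
        have "g = posynomial A ?d + (r * Poly_Mapping.lookup (snd g) \<beta>') *\<^sub>R m"
        proof (rule signomial_eqI)
          have "m \<noteq> - abs_mono \<beta>"
          proof
            assume "m = - abs_mono \<beta>"
            then have "Poly_Mapping.lookup (fst m) \<beta> = -1" by simp
            then show False by (simp add: 2(1))
          qed
          then show "?d \<alpha> = Poly_Mapping.lookup
              (fst (posynomial A ?d + (r * Poly_Mapping.lookup (snd g) \<beta>') *\<^sub>R m)) \<alpha>" for \<alpha>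
            using keys[of \<alpha>] fin by (auto simp: lookup_add lookup_fst_posynomial 2(1))
          show "Poly_Mapping.lookup (snd g) \<gamma> = Poly_Mapping.lookup
              (snd (posynomial A ?d + (r * Poly_Mapping.lookup (snd g) \<beta>') *\<^sub>R m)) \<gamma>" for \<gamma>
            using odd_terms[of \<gamma>] 2(2) by (auto simp: 2(1))
        qed
        then show thesis by (rule that)
      qed
    qed
    have eval_g: "torus_eval s w g = (\<Sum>\<alpha>\<in>A. ?d \<alpha> * exp (\<alpha> \<bullet> w)) - u * exp (\<beta> \<bullet> w)" for w
      using arg_cong[OF u, of "torus_eval s w"]
      by (simp add: torus_eval_add torus_eval_posynomial torus_eval_scaleR s(2))
    have bound: "u * exp (\<beta> \<bullet> w) \<le> (\<Sum>\<alpha>\<in>A. ?d \<alpha> * exp (\<alpha> \<bullet> w))" for w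
    proof -
      have "0 \<le> torus_eval s w g" using gs g s(1) by (auto simp: nonneg_AG_def sig_nonneg_iff_torus)
      then show ?thesis by (simp add: eval_g)
    qed
    have g_tight: "u * exp (\<beta> \<bullet> w0) = (\<Sum>\<alpha>\<in>A. ?d \<alpha> * exp (\<alpha> \<bullet> w0))"
      using zero[OF g] by (simp add: eval_g)
    define t where "t = u / b"
    have d: "?d \<alpha> = t * c \<alpha>" if "\<alpha> \<in> A" for \<alpha>
    proof -
      have "?d \<alpha> * exp (\<alpha> \<bullet> w0) = u * exp (\<beta> \<bullet> w0) * circuit_coeff A \<beta> \<alpha>"
        using exp_bound_tight_gradient[OF bound g_tight] g_tight that
        by (intro circuit_coeff_unique[OF circ, of "\<lambda>\<alpha>. ?d \<alpha> * exp (\<alpha> \<bullet> w0)"]) simp_all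
      also have "\<dots> = t * (b * circuit_coeff A \<beta> \<alpha> * exp (\<beta> \<bullet> w0))"
        using b by (simp add: t_def)
      also have "\<dots> = t * c \<alpha> * exp (\<alpha> \<bullet> w0)"
        by (simp add: tight[OF that, symmetric])
      finally show ?thesis by simp
    qed
    have "posynomial A ?d = posynomial A (\<lambda>\<alpha>. t * c \<alpha>)"
      unfolding posynomial_def by (intro sum.cong) (auto simp: d)
    then have "g = posynomial A (\<lambda>\<alpha>. t * c \<alpha>) + u *\<^sub>R m" using u by metis
    moreover have "u = t * b" using b by (simp add: t_def)
    ultimately have g_eq: "g = t *\<^sub>R ?f"
      by (simp add: posynomial_scaleR scaleR_add_right)
    have "0 \<le> t"
    proof (rule ccontr)
      \<comment> \<open>A negative factor would turn all outer coefficients negative. An AG function has at most one such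
        coefficient, but an even circuit has at least two outer exponents.\<close>
      assume "\<not> 0 \<le> t"
      then have "?d \<alpha> < 0" if "\<alpha> \<in> A" for \<alpha>
        using d[OF that] c[OF that] by (simp add: mult_neg_pos)
      then have neg: "A \<subseteq> {\<alpha>. ?d \<alpha> < 0}" by blast
      then have "\<not> odd_AG g"
        using \<open>A \<noteq> {}\<close> by (auto simp: odd_AG_def not_le)
      then have even: "card {\<alpha>. ?d \<alpha> < 0} \<le> 1" "snd g = 0"
        using gs g by (auto simp: nonneg_AG_def AG_def even_AG_def)
      have "(t * b) *\<^sub>R snd m = 0"
        using arg_cong[OF g_eq, of snd] even(2) by simp
      then have "snd m = 0" using b \<open>\<not> 0 \<le> t\<close> by auto
      then have "m = - abs_mono \<beta>"
      proof -
        have "snd (nat_mono \<beta>') \<noteq> 0" for \<beta>' :: "nat^'a"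
        proof
          assume "snd (nat_mono \<beta>') = 0"
          then have "Poly_Mapping.lookup (snd (nat_mono \<beta>')) \<beta>' = 0" by (simp only: lookup_zero)
          then show False by simp
        qed
        then show ?thesis using m(1) \<open>snd m = 0\<close> unfolding inner_term_def by auto
      qed
      then have "1 < card A" using circuit_card_gt_one[OF circ] m(3) by blast
      moreover have "finite {\<alpha>. ?d \<alpha> < 0}"
        by (rule finite_subset[of _ "Poly_Mapping.keys (fst g)"]) (auto simp: in_keys_iff)
      then have "card A \<le> card {\<alpha>. ?d \<alpha> < 0}" using neg by (intro card_mono)
      ultimately show False using even(1) by linarith
    qed
    then show ?thesis using g_eq by blast
  qed
  ultimately show ?thesis
    unfolding b_def[symmetric] by (rule generates_extreme_ray_if_generators)
qed

text \<open>Summands of \<open>|x|^\<beta>\<close> have no exponents other than \<open>\<beta>\<close>, and \<open>x^\<beta>\<close> is not available.\<close>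

lemma monomial_extreme:
  assumes \<B>: "\<forall>\<beta>\<in>\<B>. \<not> (\<forall>j. even (\<beta> $ j))"
    and \<beta>: "\<beta> \<in> \<A>" "\<beta> \<notin> real_vec ` \<B>" and r: "0 < r"
  shows "generates_extreme_ray (S_cone \<A> \<B>) (r *\<^sub>R abs_mono \<beta>)"
proof (rule generates_extreme_ray_if_generators)
  let ?f = "r *\<^sub>R abs_mono \<beta>"
  have "posynomial {\<beta>} (\<lambda>_. r) \<in> nonneg_AG \<A> \<B>"
    using \<beta> r by (intro posynomial_in_nonneg_AG) auto
  then show "?f \<in> nonneg_AG \<A> \<B>" by (simp add: posynomial_def)
  have lookup_f: "Poly_Mapping.lookup (fst ?f) \<alpha> = (if \<alpha> = \<beta> then r else 0)" for \<alpha> by simp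
  show "?f \<noteq> 0"
  proof
    assume "?f = 0"
    then have "Poly_Mapping.lookup (fst ?f) \<beta> = 0" by (simp only: fst_zero lookup_zero)
    then show False using r by (simp add: lookup_f)
  qed
  fix gs g
  assume gs: "set gs \<subseteq> nonneg_AG \<A> \<B>" and f: "?f = sum_list gs" and g: "g \<in> set gs"
  let ?t = "Poly_Mapping.lookup (fst g) \<beta>"
  have "pos_keys ?f \<subseteq> {\<beta>}"
    unfolding pos_keys_def lookup_f by auto
  then have "convex hull pos_keys ?f \<subseteq> {\<beta>}"
    using hull_mono[of "pos_keys ?f" "{\<beta>}" convex] by simp
  then have keys: "Poly_Mapping.keys (fst g) \<subseteq> {\<beta>}" "real_vec ` Poly_Mapping.keys (snd g) \<subseteq> {\<beta>}"
    using summand_keys_in_hull[OF \<B> gs g] unfolding f by blast+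
  have "Poly_Mapping.keys (snd g) \<subseteq> \<B>"
    using gs g by (auto simp: nonneg_AG_def sig_space_def)
  then have "Poly_Mapping.keys (snd g) = {}" using keys(2) \<beta>(2) by blast
  then have "snd g = 0" by simp
  have g_eq: "g = ?t *\<^sub>R abs_mono \<beta>"
  proof (rule signomial_eqI)
    show "Poly_Mapping.lookup (fst g) \<alpha> = Poly_Mapping.lookup (fst (?t *\<^sub>R abs_mono \<beta>)) \<alpha>" for \<alpha>
      using keys(1) by (auto simp: in_keys_iff)
  qed (simp add: \<open>snd g = 0\<close>)
  have "0 \<le> torus_eval 1 0 g"
    using gs g one_in_sign_vecs by (auto simp: nonneg_AG_def sig_nonneg_iff_torus)
  moreover have "torus_eval 1 0 g = ?t"
    using arg_cong[OF g_eq, of "torus_eval 1 0"] by (simp add: torus_eval_scaleR torus_eval_abs_mono)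
  ultimately have "0 \<le> ?t / r" using r by simp
  moreover have "g = (?t / r) *\<^sub>R ?f" using g_eq r by simp
  ultimately show "\<exists>t\<ge>0. g = t *\<^sub>R ?f" by blast
qed


section \<open>The extreme rays\<close>

lemma circuit_number_singleton:
  fixes \<beta> :: "real^'n::finite"
  assumes "0 < c \<beta>"
  shows "circuit_number {\<beta>} \<beta> c = c \<beta>"
proof (rule circuit_number_eq_if_tight[OF circuit_singleton assms])
  show "c \<alpha> * exp (\<alpha> \<bullet> 0) = c \<beta> * circuit_coeff {\<beta>} \<beta> \<alpha> * exp (\<beta> \<bullet> 0)" if "\<alpha> \<in> {\<beta>}" for \<alpha>
    using that circuit_coeff_sum[OF circuit_singleton, of \<beta>] by simp
qed

lemma mem_E_odd_iff:
  "f \<in> E_odd A \<beta> \<longleftrightarrow> (\<exists>c m. (\<forall>\<alpha>\<in>A. 0 < c \<alpha>) \<and> (m = nat_mono \<beta> \<or> m = - nat_mono \<beta>) \<and>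
    f = posynomial A c + circuit_number A (real_vec \<beta>) c *\<^sub>R m)"
proof -
  have minus: "x - r *\<^sub>R y = x + r *\<^sub>R (- y)" for x y :: "'a signomial" and r by simp
  show ?thesis unfolding E_odd_def posynomial_def[symmetric] minus by blast
qed

lemma mem_E_one_iff:
  assumes "\<beta> \<in> real_vec ` \<B>"
  shows "f \<in> E_one \<B> \<beta> \<longleftrightarrow> (\<exists>\<beta>'\<in>\<B>. \<exists>t m. real_vec \<beta>' = \<beta> \<and> 0 \<le> t \<and>
    (m = nat_mono \<beta>' \<or> m = - nat_mono \<beta>') \<and> f = t *\<^sub>R (abs_mono \<beta> + m))"
proof -
  have minus: "abs_mono \<beta> - y = abs_mono \<beta> + (- y)" for y by simp
  have "E_one \<B> \<beta> = (\<Union>\<beta>'\<in>{\<beta>' \<in> \<B>. real_vec \<beta>' = \<beta>}.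
      {t *\<^sub>R (abs_mono \<beta> + nat_mono \<beta>') | t. 0 \<le> t} \<union>
      {t *\<^sub>R (abs_mono \<beta> + (- nat_mono \<beta>')) | t. 0 \<le> t})"
    using assms unfolding E_one_def minus by simp
  then show ?thesis by blast
qed

lemma extreme_ray_cases:
  fixes \<A> :: "(real^'n) set" and \<B> :: "(nat^'n) set"
  assumes \<B>: "\<forall>\<beta>\<in>\<B>. \<not> (\<forall>j. even (\<beta> $ j))"
    and ext: "generates_extreme_ray (S_cone \<A> \<B>) f"
  shows "f \<in> (\<Union>(A, \<beta>)\<in>{(A, \<beta>) \<in> circuits_even \<A>. r_even \<A> A \<beta> = 0 \<and> card A > 1}. E_even A \<beta>) \<union>
     (\<Union>(A, \<beta>)\<in>{(A, \<beta>) \<in> circuits_odd \<A> \<B>. r_odd \<A> A = 0 \<and> card A > 1}. E_odd A \<beta>) \<union>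
     (\<Union>\<beta>\<in>\<A>. E_one \<B> \<beta>)"
    (is "_ \<in> ?even \<union> ?odd \<union> ?one")
proof -
  have f: "f \<in> nonneg_AG \<A> \<B>" using extreme_ray_in_nonneg_AG[OF ext] .
  define P where "P = pos_keys f"
  define c where "c = Poly_Mapping.lookup (fst f)"
  have P: "finite P" "P \<subseteq> \<A>"
    using finite_pos_keys[of f] f by (auto simp: P_def pos_keys_def nonneg_AG_def sig_space_def in_keys_iff subset_iff)
  have c: "0 < c \<alpha>" if "\<alpha> \<in> P" for \<alpha> using that by (simp add: P_def c_def pos_keys_def)
  consider "f = posynomial P c"
    | b m \<beta> where "f = posynomial P c + b *\<^sub>R m" "0 < b" "inner_term m \<beta>" "m \<in> sig_space \<A> \<B>"
        "m = - abs_mono \<beta> \<Longrightarrow> \<beta> \<notin> P"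
    using AG_normal_form[OF \<B> f] unfolding P_def c_def by metis
  then show ?thesis
  proof cases
    case 1
    then have "f \<in> ?one" using extreme_ray_posynomial[of \<A> \<B> P c] ext P c \<B> by simp
    then show ?thesis by blast
  next
    case 2
    have ext': "generates_extreme_ray (S_cone \<A> \<B>) (posynomial P c + b *\<^sub>R m)"
      using ext 2(1) by simp
    obtain w0 where circ: "circuit P \<beta>" and
      tight: "\<And>\<alpha>. \<alpha> \<in> P \<Longrightarrow> c \<alpha> * exp (\<alpha> \<bullet> w0) = b * circuit_coeff P \<beta> \<alpha> * exp (\<beta> \<bullet> w0)"
      using extreme_ray_imp_circuit[OF ext' P c 2(2-5)] by blast
    have b: "b = circuit_number P \<beta> c"
      using circuit_number_eq_if_tight[OF circ 2(2) tight] by simp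
    have reduced: "m = - abs_mono \<beta> \<and> \<gamma> = \<beta>"
      if "\<gamma> \<in> convex hull P" "\<gamma> \<in> \<A>" "\<gamma> \<notin> P" for \<gamma>
      using extreme_ray_circuit_reduced[OF ext' P(2) 2(2-4) circ tight that] .
    consider "m = - abs_mono \<beta>"
      | \<beta>' where "m \<noteq> - abs_mono \<beta>" "real_vec \<beta>' = \<beta>" "m = nat_mono \<beta>' \<or> m = - nat_mono \<beta>'"
      using 2(3) unfolding inner_term_def by blast
    then show ?thesis
    proof cases
      case 1
      have "\<beta> \<in> \<A>"
        using 2(4) by (auto simp: 1 sig_space_iff_lookup)
      then have "(P, \<beta>) \<in> circuits_even \<A>"
        using P(2) circ by (simp add: circuits_even_def)
      moreover have "(convex hull P - (P \<union> {\<beta>})) \<inter> \<A> = {}"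
        using reduced by blast
      then have "r_even \<A> P \<beta> = 0" by (simp add: r_even_def)
      moreover have "card P > 1" using circuit_card_gt_one[OF circ] 2(5) 1 by blast
      moreover have "f \<in> E_even P \<beta>"
        using 2(1) c unfolding E_even_def b[symmetric] by (auto simp: 1 posynomial_def b[symmetric] intro!: exI[of _ c])
      ultimately have "f \<in> ?even" by blast
      then show ?thesis by blast
    next
      \<comment> \<open>If \<open>\<beta>\<close> is an outer exponent, the circuit is degenerate and \<open>f\<close> is a multiple of \<open>|x|^\<beta> \<plusminus> x^\<beta>\<close>.\<close>
      case 2: 2
      have "\<beta>' \<in> \<B>"
        using \<open>m \<in> sig_space \<A> \<B>\<close> 2(3) by (auto simp: sig_space_iff_lookup)
      show ?thesis
      proof (cases "\<beta> \<in> P")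
        case True
        then have "P = {\<beta>}" using circuit_eq_singleton[OF circ] by blast
        then have "b = c \<beta>" using b circuit_number_singleton[of c \<beta>] c by simp
        then have "f = c \<beta> *\<^sub>R (abs_mono \<beta> + m)"
          using \<open>f = posynomial P c + b *\<^sub>R m\<close> \<open>P = {\<beta>}\<close> by (simp add: posynomial_def scaleR_add_right)
        moreover have "0 \<le> c \<beta>" using c[OF True] by simp
        moreover have "\<beta> \<in> real_vec ` \<B>" using \<open>\<beta>' \<in> \<B>\<close> 2(2) by blast
        ultimately have "f \<in> E_one \<B> \<beta>"
          using \<open>\<beta>' \<in> \<B>\<close> 2(2,3) unfolding mem_E_one_iff[OF \<open>\<beta> \<in> real_vec ` \<B>\<close>] by blast
        then show ?thesis using P(2) True by blast
      next
        case False
        have "(P, \<beta>') \<in> circuits_odd \<A> \<B>"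
          using P(2) circ \<open>\<beta>' \<in> \<B>\<close> 2(2) by (simp add: circuits_odd_def)
        moreover have "(convex hull P - P) \<inter> \<A> = {}"
          using reduced 2(1) by blast
        then have "r_odd \<A> P = 0" by (simp add: r_odd_def)
        moreover have "card P > 1" using circuit_card_gt_one[OF circ False] .
        moreover have "f \<in> E_odd P \<beta>'"
        proof -
          have "f = posynomial P c + circuit_number P (real_vec \<beta>') c *\<^sub>R m"
            using \<open>f = posynomial P c + b *\<^sub>R m\<close> b 2(2) by simp
          then show ?thesis
            using 2(3) c unfolding mem_E_odd_iff by blast
        qed
        ultimately have "f \<in> ?odd" by blast
        then show ?thesis by blast
      qed
    qed
  qed
qed

lemma E_even_extreme:
  fixes \<A> :: "(real^'n) set" and \<B> :: "(nat^'n) set"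
  assumes fin: "finite \<A>" and \<B>: "\<forall>\<beta>\<in>\<B>. \<not> (\<forall>j. even (\<beta> $ j))"
    and A: "(A, \<beta>) \<in> circuits_even \<A>" "r_even \<A> A \<beta> = 0" "card A > 1"
    and f: "f \<in> E_even A \<beta>"
  shows "generates_extreme_ray (S_cone \<A> \<B>) f"
proof -
  have circ: "A \<subseteq> \<A>" "\<beta> \<in> \<A>" "circuit A \<beta>" using A(1) by (auto simp: circuits_even_def)
  obtain c where c: "f = posynomial A c + circuit_number A \<beta> c *\<^sub>R (- abs_mono \<beta>)" "\<forall>\<alpha>\<in>A. 0 < c \<alpha>"
    using f by (auto simp: E_even_def posynomial_def)
  have "(convex hull A - (A \<union> {\<beta>})) \<inter> \<A> = {}"
    using A(2) fin by (simp add: r_even_def)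
  moreover have "\<beta> \<notin> A"
    using circuit_eq_singleton[OF circ(3)] A(3) by force
  ultimately show ?thesis
    unfolding c(1) using circ c(2)
    by (intro reduced_circuit_function_extreme[OF \<B>]) (auto simp: inner_term_def sig_space_iff_lookup)
qed

text \<open>The circuit may be degenerate: with \<open>A = {\<beta>}\<close> this covers \<open>|x|^\<beta> \<plusminus> x^\<beta>\<close>.\<close>

lemma odd_circuit_function_extreme:
  fixes \<A> :: "(real^'n) set" and \<B> :: "(nat^'n) set"
  assumes fin: "finite \<A>" and \<B>: "\<forall>\<beta>\<in>\<B>. \<not> (\<forall>j. even (\<beta> $ j))"
    and A: "A \<subseteq> \<A>" "\<beta> \<in> \<B>" "circuit A (real_vec \<beta>)" "r_odd \<A> A = 0"
    and c: "\<forall>\<alpha>\<in>A. 0 < c \<alpha>" and m: "m = nat_mono \<beta> \<or> m = - nat_mono \<beta>"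
  shows "generates_extreme_ray (S_cone \<A> \<B>) (posynomial A c + circuit_number A (real_vec \<beta>) c *\<^sub>R m)"
proof -
  have "(convex hull A - A) \<inter> \<A> = {}"
    using A(4) fin by (simp add: r_odd_def)
  moreover have "inner_term m (real_vec \<beta>)"
    using m \<B> A(2) unfolding inner_term_def by blast
  moreover have "m \<in> sig_space \<A> \<B>"
    using m A(2) by (auto simp: sig_space_iff_lookup)
  moreover have "m \<noteq> - abs_mono (real_vec \<beta>)"
  proof
    assume "m = - abs_mono (real_vec \<beta>)"
    then have "Poly_Mapping.lookup (fst m) (real_vec \<beta>) = -1" by simp
    then show False using m by auto
  qed
  ultimately show ?thesis
    using A c by (intro reduced_circuit_function_extreme[OF \<B>]) auto
qed

lemma E_one_extreme:
  fixes \<A> :: "(real^'n) set" and \<B> :: "(nat^'n) set"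
  assumes fin: "finite \<A>" and \<B>: "\<forall>\<beta>\<in>\<B>. \<not> (\<forall>j. even (\<beta> $ j))"
    and \<beta>: "\<beta> \<in> \<A>" and f: "f \<in> E_one \<B> \<beta>" "f \<noteq> 0"
  shows "generates_extreme_ray (S_cone \<A> \<B>) f"
proof (cases "\<beta> \<in> real_vec ` \<B>")
  case False
  then obtain t where "0 \<le> t" "f = t *\<^sub>R abs_mono \<beta>" using f(1) by (auto simp: E_one_def)
  moreover have "t \<noteq> 0" using f(2) \<open>f = t *\<^sub>R abs_mono \<beta>\<close> by auto
  ultimately show ?thesis
    using monomial_extreme[OF \<B> \<beta> False, of t] by simp
next
  case True
  then obtain \<beta>' t m where \<beta>': "\<beta>' \<in> \<B>" "real_vec \<beta>' = \<beta>" and t: "0 \<le> t"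
    and m: "m = nat_mono \<beta>' \<or> m = - nat_mono \<beta>'" and f_eq: "f = t *\<^sub>R (abs_mono \<beta> + m)"
    using f(1) unfolding mem_E_one_iff[OF True] by blast
  have "0 < t" using t f(2) f_eq by (cases "t = 0") auto
  have "r_odd \<A> {\<beta>} = 0" by (simp add: r_odd_def)
  then have "generates_extreme_ray (S_cone \<A> \<B>)
      (posynomial {\<beta>} (\<lambda>_. t) + circuit_number {\<beta>} (real_vec \<beta>') (\<lambda>_. t) *\<^sub>R m)"
    using \<open>0 < t\<close> \<beta> \<beta>' m circuit_singleton[of \<beta>]
    by (intro odd_circuit_function_extreme[OF fin \<B>]) auto
  then show ?thesis
    using circuit_number_singleton[of "\<lambda>_. t" \<beta>] \<open>0 < t\<close> \<beta>'(2)
    by (simp add: f_eq posynomial_def scaleR_add_right)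
qed

theorem proposition4p4:
  fixes \<A> :: "(real^'n) set" and \<B> :: "(nat^'n) set"
  assumes "finite \<A>" and "\<A> \<noteq> {}"
    and "finite \<B>" and "\<forall>\<beta>\<in>\<B>. \<not> (\<forall>j. even (\<beta> $ j))"
  shows "{f. generates_extreme_ray (S_cone \<A> \<B>) f} =
    ((\<Union>(A, \<beta>)\<in>{(A, \<beta>) \<in> circuits_even \<A>. r_even \<A> A \<beta> = 0 \<and> card A > 1}. E_even A \<beta>) \<union>
     (\<Union>(A, \<beta>)\<in>{(A, \<beta>) \<in> circuits_odd \<A> \<B>. r_odd \<A> A = 0 \<and> card A > 1}. E_odd A \<beta>) \<union>
     (\<Union>\<beta>\<in>\<A>. E_one \<B> \<beta>)) - {0}"
    (is "?lhs = (?even \<union> ?odd \<union> ?one) - {0}")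
proof (intro subset_antisym subsetI)
  fix f assume "f \<in> ?lhs"
  then have ext: "generates_extreme_ray (S_cone \<A> \<B>) f" by simp
  then have "f \<noteq> 0" by (simp add: generates_extreme_ray_def)
  then show "f \<in> (?even \<union> ?odd \<union> ?one) - {0}"
    using extreme_ray_cases[OF assms(4) ext] by blast
next
  fix f assume "f \<in> (?even \<union> ?odd \<union> ?one) - {0}"
  then consider "f \<in> ?even" | "f \<in> ?odd" | "f \<in> ?one" "f \<noteq> 0" by blast
  then have "generates_extreme_ray (S_cone \<A> \<B>) f"
  proof cases
    case 1
    then show ?thesis using E_even_extreme[OF assms(1,4)] by blast
  next
    case 2
    then obtain A \<beta> where A: "A \<subseteq> \<A>" "\<beta> \<in> \<B>" "circuit A (real_vec \<beta>)" "r_odd \<A> A = 0"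
      and f: "f \<in> E_odd A \<beta>" by (auto simp: circuits_odd_def)
    then show ?thesis
      using odd_circuit_function_extreme[OF assms(1,4) A] unfolding mem_E_odd_iff by blast
  next
    case 3
    then show ?thesis using E_one_extreme[OF assms(1,4)] by blast
  qed
  then show "f \<in> ?lhs" by simp
qed


end
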